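(* Let $d\ge1$ and let $\varphi:\mathbb{Z}^d\to\mathbb{C}$ be such that the trigonometric series $\sum_{k\in\mathbb{Z}^d}\varphi(k)e^{i(k,x)}$ is the Fourier series of a function $\Phi\in L_1(\mathbb{T}^d)$. Then $$\frac{1}{(2\pi)^d}\int_{\mathbb{T}^d}|\Phi(x)|\,dx=\min_{\varphi_c}\|\varphi_c\|_{A(\mathbb{R}^d)},$$ where the minimum is taken over all $\varphi_c\in A(\mathbb{R}^d)$ with $\varphi_c(k)=\varphi(k)$ for all $k\in\mathbb{Z}^d$ (in particular the minimum is attained). Moreover, among such extensions of $\varphi$ with minimal norm there exists exactly one that is (the restriction to $\mathbb{R}^d$ of) an entire function of exponential type at most $\pi$ in each of the variables $x_1,\dots,x_d$.
   Context: $\mathbb{T}=[-\pi,\pi]$; for $x,y\in\mathbb{R}^d$, $(x,y)=\sum_{j=1}^d x_jy_j$. That $\sum_k\varphi(k)e^{i(k,x)}$ is the Fourier series of $\Phi$ means $\varphi(k)=\frac{1}{(2\pi)^d}\int_{\mathbb{T}^d}\Phi(x)e^{-i(k,x)}\,dx$ for all $k\in\mathbb{Z}^d$. The Wiener algebra $A(\mathbb{R}^d)$ is the set of all functions $f$ of the form $f(x)=\int_{\mathbb{R}^d} g(y)e^{-i(x,y)}\,dy$ ($x\in\mathbb{R}^d$) with $g\in L_1(\mathbb{R}^d)$; its norm is $\|f\|_{A(\mathbb{R}^d)}=\int_{\mathbb{R}^d}|g(y)|\,dy$. *)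

theory Defs
  imports "HOL-Analysis.Analysis"
begin

definition torus_box :: "(real ^ 'd) set" where
  "torus_box = cbox (\<chi> j. - pi) (\<chi> j. pi)"

definition lattice_point :: "int ^ 'd \<Rightarrow> real ^ 'd" where
  "lattice_point k = (\<chi> j. real_of_int (k $ j))"

text \<open>Only the values of \<open>\<Phi>\<close> on the cube matter; \<open>CARD('d)\<close> is the dimension.\<close>

definition fourier_coefficient :: "(real ^ 'd \<Rightarrow> complex) \<Rightarrow> int ^ 'd \<Rightarrow> complex" where
  "fourier_coefficient \<Phi> k =
     1 / complex_of_real ((2 * pi) ^ CARD('d)) *
     (LINT x:torus_box|lebesgue. \<Phi> x * exp (- \<i> * complex_of_real (lattice_point k \<bullet> x)))"

definition is_fourier_series_of :: "(int ^ 'd \<Rightarrow> complex) \<Rightarrow> (real ^ 'd \<Rightarrow> complex) \<Rightarrow> bool" where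
  "is_fourier_series_of \<phi> \<Phi> \<longleftrightarrow> (\<forall>k. \<phi> k = fourier_coefficient \<Phi> k)"

definition wiener_represents :: "(real ^ 'd \<Rightarrow> complex) \<Rightarrow> (real ^ 'd \<Rightarrow> complex) \<Rightarrow> bool" where
  "wiener_represents g f \<longleftrightarrow>
     integrable lebesgue g \<and>
     (\<forall>x. f x = (LINT y|lebesgue. g y * exp (- \<i> * complex_of_real (x \<bullet> y))))"

definition wiener_algebra :: "(real ^ 'd \<Rightarrow> complex) set" where
  "wiener_algebra = {f. \<exists>g. wiener_represents g f}"

text \<open>The representing function is unique up to a null set (uniqueness of the Fourier
  transform on \<open>L\<^sub>1\<close>), so the norm of \<open>f \<in> wiener_algebra\<close> does not depend on the
  choice below. Outside the algebra the value is meaningless.\<close>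

definition wiener_norm :: "(real ^ 'd \<Rightarrow> complex) \<Rightarrow> real" where
  "wiener_norm f = (LINT y|lebesgue. cmod ((SOME g. wiener_represents g f) y))"

definition wiener_extensions :: "(int ^ 'd \<Rightarrow> complex) \<Rightarrow> (real ^ 'd \<Rightarrow> complex) set" where
  "wiener_extensions \<phi> = {f \<in> wiener_algebra. \<forall>k. f (lattice_point k) = \<phi> k}"

text \<open>Joint holomorphy on the whole of complex \<open>d\<close>-space: the real Frechet derivative exists
  at every point and is complex linear.\<close>

definition entire_multi :: "(complex ^ 'd \<Rightarrow> complex) \<Rightarrow> bool" where
  "entire_multi F \<longleftrightarrow>
     (\<forall>z. \<exists>D. (F has_derivative D) (at z) \<and> (\<forall>c v. D (c *s v) = c * D v))"

definition exponential_type_le :: "real \<Rightarrow> (complex \<Rightarrow> complex) \<Rightarrow> bool" where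
  "exponential_type_le \<sigma> h \<longleftrightarrow>
     (\<forall>\<epsilon>>0. \<exists>C. \<forall>w. cmod (h w) \<le> C * exp ((\<sigma> + \<epsilon>) * cmod w))"

text \<open>The constant may depend on the remaining (complex) variables. For functions bounded on
  real \<open>d\<close>-space, such as elements of the Wiener algebra, applying the one-variable bound
  successively in each variable shows that this agrees with the joint bound
  \<open>C * exp (\<Sum>j. (\<sigma> + \<epsilon>) * cmod (z $ j))\<close>.\<close>

definition exponential_type_each_le :: "real \<Rightarrow> (complex ^ 'd \<Rightarrow> complex) \<Rightarrow> bool" where
  "exponential_type_each_le \<sigma> F \<longleftrightarrow>
     (\<forall>j z. exponential_type_le \<sigma> (\<lambda>w. F (\<chi> i. if i = j then w else z $ i)))"

definition restricts_entire_of_type :: "real \<Rightarrow> (real ^ 'd \<Rightarrow> complex) \<Rightarrow> bool" where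
  "restricts_entire_of_type \<sigma> f \<longleftrightarrow>
     (\<exists>F :: complex ^ 'd \<Rightarrow> complex. entire_multi F \<and> exponential_type_each_le \<sigma> F \<and>
        (\<forall>x. f x = F (\<chi> j. complex_of_real (x $ j))))"

end

theory Submission
  imports Defs "HOL-Complex_Analysis.Conformal_Mappings" "HOL-Real_Asymp.Real_Asymp"
begin

text \<open>
  Let \<open>g\<^sub>0\<close> be \<open>\<Phi> / (2 * pi) ^ d\<close> on the cube and \<open>0\<close> elsewhere. Its transform \<open>f\<^sub>0\<close>
  interpolates \<open>\<phi>\<close> on the lattice, has the asserted norm, and is entire of exponential type
  \<open>pi\<close> in each variable because its spectrum lies in the cube
  (\<open>restricts_entire_of_box_support\<close>). If \<open>g\<close> represents another extension, the transform of
  \<open>g - g\<^sub>0\<close> vanishes at all lattice points, so \<open>g\<close> and \<open>g\<^sub>0\<close> have the same periodization,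
  and periodization does not increase the \<open>L\<^sub>1\<close> norm.

  The last step is carried out by duality. A function whose transform vanishes on \<open>a\<close> times the
  integer lattice annihilates every bounded Borel function of period \<open>2 * pi / a\<close>
  in each variable: trigonometric
  polynomials trivially, continuous functions by the Stone--Weierstrass theorem, then indicators
  of Borel sets and their limits (\<open>integral_bounded_torus\<close>). Testing against the periodic
  continuation of the conjugate sign of the function itself shows that its mass inside one
  period cell is at most its mass outside (\<open>mass_in_period_cell_le\<close>). This inequality is used
  three times. For \<open>g - g\<^sub>0\<close> and \<open>a = 1\<close> it gives the lower bound for the norm. If moreover
  \<open>g\<close> lives on the cube, it gives \<open>g = g\<^sub>0\<close>. As \<open>a\<close> tends to \<open>0\<close>
  it gives injectivity of the Fourier transform on \<open>L\<^sub>1\<close>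
  (\<open>fourier_transform_zero_imp_AE_zero\<close>), hence that \<open>wiener_norm\<close> may be computed from any
  representing function.

  For uniqueness of the entire minimiser it remains to see that an element of the Wiener algebra
  which is entire of type \<open>pi\<close> in each variable has its spectrum in the cube
  (\<open>paley_wiener_support\<close>). By injectivity this can be done one coordinate and one side at a
  time. Along a line, a Phragmen--Lindelof argument bounds the function times \<open>exp (\<i> * pi * w)\<close>
  on the upper half-plane. Subtracting the part with frequencies at most \<open>pi\<close>, which is bounded
  there as well, leaves a bounded holomorphic function whose boundary values are also those of a
  bounded holomorphic function on the lower half-plane, namely the part with frequencies above
  \<open>pi\<close>. The two paste to a bounded entire function, which is constant and tends to
  \<open>0\<close> along the negative imaginary axis (\<open>spectrum_above_type_vanishes\<close>).
\<close>

section \<open>Phragmen--Lindelof bounds\<close>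

text \<open>The factor \<open>exp (- \<delta> * P)\<close> is harmless on the boundary and beats the growth of \<open>f\<close> at
infinity, so the maximum modulus principle applies on a large bounded piece of \<open>S\<close>; then
\<open>\<delta>\<close> tends to \<open>0\<close>.\<close>

lemma phragmen_lindelof_principle:
  fixes f P :: "complex \<Rightarrow> complex"
  assumes "open S" and "f holomorphic_on S" and "continuous_on (closure S) f"
    and "P holomorphic_on S" and "continuous_on (closure S) P"
    and P_nonneg: "\<And>z. z \<in> closure S \<Longrightarrow> 0 \<le> Re (P z)"
    and "M > 0" and boundary: "\<And>z. z \<in> frontier S \<Longrightarrow> cmod (f z) \<le> M"
    and growth: "\<And>\<delta>. \<delta> > 0 \<Longrightarrow>
      \<exists>R. \<forall>z\<in>closure S. R \<le> cmod z \<longrightarrow> cmod (f z) * exp (- (\<delta> * Re (P z))) \<le> M"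
    and "w \<in> S"
  shows "cmod (f w) \<le> M"
proof -
  have bound: "cmod (f w) \<le> M * exp (\<delta> * Re (P w))" if \<delta>: "\<delta> > 0" for \<delta>
  proof -
    obtain R where R: "\<And>z. z \<in> closure S \<Longrightarrow> R \<le> cmod z \<Longrightarrow> cmod (f z) * exp (- (\<delta> * Re (P z))) \<le> M"
      using growth[OF \<delta>] by blast
    define T where "T = S \<inter> ball 0 (max R (cmod w + 1))"
    have T_closure: "closure T \<subseteq> closure S"
      by (simp add: T_def closure_mono)
    have T_norm: "cmod z \<le> max R (cmod w + 1)" if "z \<in> closure T" for z
    proof -
      have "closure T \<subseteq> closure (ball 0 (max R (cmod w + 1)))"
        unfolding T_def by (rule closure_mono) auto
      also have "\<dots> \<subseteq> cball 0 (max R (cmod w + 1))"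
        by (rule closure_minimal) auto
      finally show ?thesis using that by auto
    qed
    have "open T" using \<open>open S\<close> by (simp add: T_def open_Int)
    define G where "G z = f z * exp (- (of_real \<delta> * P z))" for z
    have norm_G: "cmod (G z) = cmod (f z) * exp (- (\<delta> * Re (P z)))" for z
      by (simp add: G_def norm_mult)
    have "cmod (G w) \<le> M"
    proof (rule maximum_modulus_frontier[of G T])
      have "G holomorphic_on S"
        unfolding G_def using assms by (intro holomorphic_intros) auto
      then show "G holomorphic_on interior T"
        by (rule holomorphic_on_subset) (use \<open>open T\<close> in \<open>auto simp: interior_open T_def dest: interior_subset[THEN subsetD]\<close>)
      have "continuous_on (closure S) G"
        unfolding G_def using assms by (intro continuous_intros) auto
      then show "continuous_on (closure T) G"
        by (rule continuous_on_subset) (rule T_closure)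
      show "bounded T" unfolding T_def by (simp add: bounded_Int)
      show "w \<in> T" using \<open>w \<in> S\<close> by (simp add: T_def)
      fix z assume "z \<in> frontier T"
      then have z: "z \<in> closure T" "z \<notin> T"
        using \<open>open T\<close> by (auto simp: frontier_def interior_open)
      then have zS: "z \<in> closure S" using T_closure by auto
      show "cmod (G z) \<le> M"
      proof (cases "z \<in> S")
        case True
        then have "R \<le> cmod z" using z by (auto simp: T_def)
        then show ?thesis using R[OF zS] norm_G by simp
      next
        case False
        then have "cmod (f z) \<le> M"
          using zS \<open>open S\<close> by (intro boundary) (simp add: frontier_def interior_open)
        moreover have "exp (- (\<delta> * Re (P z))) \<le> 1"
          using P_nonneg[OF zS] \<delta> by simp
        ultimately have "cmod (f z) * exp (- (\<delta> * Re (P z))) \<le> M * 1"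
          by (intro mult_mono) (use \<open>M > 0\<close> in auto)
        then show ?thesis using norm_G by simp
      qed
    qed
    then have "cmod (f w) / exp (\<delta> * Re (P w)) \<le> M" by (simp add: norm_G exp_minus divide_inverse)
    then show ?thesis by (subst (asm) pos_divide_le_eq) simp_all
  qed
  have "((\<lambda>\<delta>. M * exp (\<delta> * Re (P w))) \<longlongrightarrow> M * exp (0 * Re (P w))) (at_right 0)"
    by (intro tendsto_intros)
  then show ?thesis
    using bound by (intro tendsto_lowerbound[where F = "at_right 0"])
      (auto simp: eventually_at_right_less intro: eventually_mono[OF eventually_at_right_less])
qed

lemma closure_open_quadrant: "closure {z. 0 < Re z \<and> 0 < Im z} \<subseteq> {z. 0 \<le> Re z \<and> 0 \<le> Im z}"
  by (rule closure_minimal)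
     (auto intro!: closed_Collect_conj closed_Collect_le continuous_intros)

lemma open_quadrant: "open {z. 0 < Re z \<and> 0 < Im z}"
  by (auto intro!: open_Collect_conj open_Collect_less continuous_intros)

text \<open>Exponential type is growth of order one, while a quadrant admits comparison functions of any order
below two. The choice here is a power \<open>3/2\<close>, rotated so that its real part is positive on the
quadrant.\<close>

lemma phragmen_lindelof_quadrant:
  assumes "f holomorphic_on UNIV" and type: "\<And>z. cmod (f z) \<le> A * exp (B * cmod z)"
    and "M > 0"
    and real_axis: "\<And>t. 0 \<le> t \<Longrightarrow> cmod (f (of_real t)) \<le> M"
    and imag_axis: "\<And>t. 0 \<le> t \<Longrightarrow> cmod (f (\<i> * of_real t)) \<le> M"
    and "0 < Re w" "0 < Im w"
  shows "cmod (f w) \<le> M"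
proof -
  define S where "S = {z. 0 < Re z \<and> 0 < Im z}"
  \<comment> \<open>The shift by \<open>1\<close> keeps the argument of the logarithm away from \<open>0\<close>; the angle \<open>pi/4\<close>
    centres the quadrant at the positive axis, so that after the power all arguments are at most
    \<open>3/8 * pi\<close>.\<close>
  define P where "P z = exp (3/2 * (Ln (z + 1) - \<i> * of_real (pi/4)))" for z
  define c where "c = cos (3/8 * pi)"
  have "c > 0" unfolding c_def by (rule cos_gt_zero_pi) (simp_all add: field_simps)
  have closure_S: "0 \<le> Re z" "0 \<le> Im z" if "z \<in> closure S" for z
    using that closure_open_quadrant by (auto simp: S_def)
  have P_ge: "c * cmod (z + 1) powr (3/2) \<le> Re (P z)" if "z \<in> closure S" for z
  proof -
    have "Re (z + 1) > 0" "Im (z + 1) \<ge> 0" using closure_S[OF that] by auto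
    then have nz: "z + 1 \<noteq> 0" by (metis less_irrefl zero_complex.sel(1))
    have "\<bar>Im (Ln (z + 1))\<bar> \<le> pi/2" "0 \<le> Im (Ln (z + 1))"
      using Re_Ln_pos_le[OF nz] Im_Ln_pos_le[OF nz] \<open>Re (z + 1) > 0\<close> \<open>Im (z + 1) \<ge> 0\<close> by auto
    then have "\<bar>3/2 * (Im (Ln (z + 1)) - pi/4)\<bar> \<le> 3/8 * pi" by (auto simp: field_simps abs_if)
    then have "cos (3/8 * pi) \<le> cos \<bar>3/2 * (Im (Ln (z + 1)) - pi/4)\<bar>"
      by (intro cos_monotone_0_pi_le) auto
    then have "c \<le> cos (3/2 * (Im (Ln (z + 1)) - pi/4))"
      by (simp only: c_def cos_abs_real)
    moreover have "exp (3/2 * Re (Ln (z + 1))) = cmod (z + 1) powr (3/2)"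
      using nz by (simp add: powr_def)
    ultimately have "c * cmod (z + 1) powr (3/2)
        \<le> cos (3/2 * (Im (Ln (z + 1)) - pi/4)) * exp (3/2 * Re (Ln (z + 1)))"
      using \<open>c > 0\<close> by (intro mult_mono) auto
    also have "\<dots> = Re (P z)"
      by (simp add: P_def Re_exp algebra_simps)
    finally show ?thesis .
  qed
  have P_hol: "P holomorphic_on {z. Re z > -1}"
    unfolding P_def by (intro holomorphic_intros) (auto simp: complex_nonpos_Reals_iff)
  have sub: "closure S \<subseteq> {z. Re z > -1}" using closure_S by fastforce
  have "open S" unfolding S_def by (rule open_quadrant)
  show ?thesis
  proof (rule phragmen_lindelof_principle[where f = f and w = w and S = S and P = P])
    show "f holomorphic_on S" by (rule holomorphic_on_subset[OF assms(1)]) auto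
    show "continuous_on (closure S) f"
      by (rule holomorphic_on_imp_continuous_on, rule holomorphic_on_subset[OF assms(1)]) auto
    show "P holomorphic_on S"
      by (rule holomorphic_on_subset[OF P_hol]) (use sub closure_subset in auto)
    show "continuous_on (closure S) P"
      by (rule holomorphic_on_imp_continuous_on, rule holomorphic_on_subset[OF P_hol sub])
    show "0 \<le> Re (P z)" if "z \<in> closure S" for z
      using P_ge[OF that] \<open>c > 0\<close> by (smt (verit) mult_nonneg_nonneg powr_ge_zero)
    show "cmod (f z) \<le> M" if "z \<in> frontier S" for z
    proof -
      have "z \<in> closure S" "z \<notin> S" using that \<open>open S\<close> by (auto simp: frontier_def interior_open)
      then have "z = of_real (Re z) \<or> z = \<i> * of_real (Im z)" "0 \<le> Re z" "0 \<le> Im z"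
        using closure_S[of z] by (auto simp: S_def complex_eq_iff)
      then show ?thesis using real_axis imag_axis by metis
    qed
    show "\<exists>R. \<forall>z\<in>closure S. R \<le> cmod z \<longrightarrow> cmod (f z) * exp (- (\<delta> * Re (P z))) \<le> M"
      if "\<delta> > 0" for \<delta>
    proof -
      define A' where "A' = max A 0"
      have "((\<lambda>x. A' * exp (B * x - \<delta> * (c * x powr (3/2)))) \<longlongrightarrow> 0) at_top"
      proof -
        have "((\<lambda>x. exp (B * x - \<delta> * (c * x powr (3/2)))) \<longlongrightarrow> 0) at_top"
          using \<open>\<delta> > 0\<close> \<open>c > 0\<close> by real_asymp
        from tendsto_mult_left[OF this, of A'] show ?thesis by simp
      qed
      then have "eventually (\<lambda>x. A' * exp (B * x - \<delta> * (c * x powr (3/2))) < M) at_top"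
        using \<open>M > 0\<close> by (rule order_tendstoD)
      then obtain R where R: "\<And>x. x \<ge> R \<Longrightarrow> A' * exp (B * x - \<delta> * (c * x powr (3/2))) < M"
        by (auto simp: eventually_at_top_linorder)
      show ?thesis
      proof (intro exI ballI impI)
        fix z assume z: "z \<in> closure S" "R \<le> cmod z"
        have "cmod z \<le> cmod (z + 1)"
          using closure_S[OF z(1)] by (auto simp: cmod_def intro!: power_mono)
        then have "cmod z powr (3/2) \<le> cmod (z + 1) powr (3/2)" by (intro powr_mono2) auto
        then have "c * cmod z powr (3/2) \<le> Re (P z)"
          using P_ge[OF z(1)] \<open>c > 0\<close> by (smt (verit) mult_left_mono)
        then have E: "exp (- (\<delta> * Re (P z))) \<le> exp (- (\<delta> * (c * cmod z powr (3/2))))"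
          using that by simp
        have "cmod (f z) \<le> A' * exp (B * cmod z)"
          using type[of z] by (smt (verit) A'_def exp_gt_zero max_def mult_right_mono)
        then have "cmod (f z) * exp (- (\<delta> * Re (P z)))
            \<le> A' * exp (B * cmod z) * exp (- (\<delta> * (c * cmod z powr (3/2))))"
          using E by (intro mult_mono) (auto simp: A'_def)
        also have "\<dots> = A' * exp (B * cmod z - \<delta> * (c * cmod z powr (3/2)))"
          by (simp add: exp_diff exp_minus field_simps)
        also have "\<dots> \<le> M" using R[OF z(2)] by simp
        finally show "cmod (f z) * exp (- (\<delta> * Re (P z))) \<le> M" .
      qed
    qed
    show "w \<in> S" using assms by (simp add: S_def)
  qed (use \<open>M > 0\<close> \<open>open S\<close> in auto)
qed

text \<open>The half-plane is too wide for comparison with order one, so it is cut along the imaginary axis,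
where growth below every exponential is assumed. A factor \<open>exp (\<i> * \<epsilon> * w)\<close> turns this into
boundedness; the quadrants then give some bound, and a logarithmic comparison function improves it
to the bound on the real line.\<close>

lemma phragmen_lindelof_half_plane:
  assumes "f holomorphic_on UNIV" and type: "\<And>z. cmod (f z) \<le> A * exp (B * cmod z)"
    and "M > 0"
    and real_axis: "\<And>t. cmod (f (of_real t)) \<le> M"
    and imag_axis: "\<And>\<epsilon>. \<epsilon> > 0 \<Longrightarrow> \<exists>C. \<forall>t\<ge>0. cmod (f (\<i> * of_real t)) \<le> C * exp (\<epsilon> * t)"
    and "0 \<le> Im w"
  shows "cmod (f w) \<le> M"
proof (cases "Im w = 0")
  case True
  then have "w = of_real (Re w)" by (simp add: complex_eq_iff)
  then show ?thesis using real_axis by metis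
next
  case False
  with \<open>0 \<le> Im w\<close> have "0 < Im w" by simp
  have bound: "cmod (f w) * exp (- (\<epsilon> * Im w)) \<le> M" if \<epsilon>: "\<epsilon> > 0" for \<epsilon>
  proof -
    obtain C where C: "\<And>t. t \<ge> 0 \<Longrightarrow> cmod (f (\<i> * of_real t)) \<le> C * exp (\<epsilon> * t)"
      using imag_axis[OF \<epsilon>] by blast
    define M' where "M' = max M C"
    define G where "G z = f z * exp (\<i> * of_real \<epsilon> * z)" for z
    have norm_G: "cmod (G z) = cmod (f z) * exp (- (\<epsilon> * Im z))" for z
      by (simp add: G_def norm_mult)
    have G_hol: "G holomorphic_on UNIV"
      unfolding G_def using assms(1) by (intro holomorphic_intros)
    have "A \<ge> 0" using order_trans[OF norm_ge_zero type[of 0]] by simp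
    have G_type: "cmod (G z) \<le> A * exp ((B + \<epsilon>) * cmod z)" for z
    proof -
      have "- (\<epsilon> * Im z) \<le> \<epsilon> * cmod z"
        using abs_Im_le_cmod[of z] \<epsilon> by (smt (verit) mult_left_mono mult_minus_right)
      then have "cmod (G z) \<le> A * exp (B * cmod z) * exp (\<epsilon> * cmod z)"
        unfolding norm_G using type[of z] \<open>A \<ge> 0\<close> by (intro mult_mono) auto
      then show ?thesis by (simp add: exp_add distrib_right)
    qed
    have "M' > 0" using \<open>M > 0\<close> by (simp add: M'_def)
    have G_real: "cmod (G (of_real t)) \<le> M'" for t
      using real_axis[of t] by (simp add: norm_G M'_def)
    have G_imag: "cmod (G (\<i> * of_real t)) \<le> M'" if "t \<ge> 0" for t
    proof -
      have "cmod (G (\<i> * of_real t)) \<le> C * exp (\<epsilon> * t) * exp (- (\<epsilon> * t))"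
        unfolding norm_G using C[OF that] by (intro mult_mono) (auto intro: order_trans[OF norm_ge_zero])
      also have "\<dots> = C" by (simp add: mult.assoc flip: exp_add)
      finally show ?thesis by (simp add: M'_def)
    qed
    have G_bounded: "cmod (G z) \<le> M'" if "Im z > 0" for z
    proof -
      consider "Re z > 0" | "Re z = 0" | "Re z < 0" by linarith
      then show ?thesis
      proof cases
        case 1
        show ?thesis
          by (rule phragmen_lindelof_quadrant[OF G_hol G_type \<open>M' > 0\<close> G_real G_imag 1 that])
      next
        case 2
        then have "z = \<i> * of_real (Im z)" by (simp add: complex_eq_iff)
        then show ?thesis by (rule ssubst) (use G_imag that in simp)
      next
        case 3
        have "cmod (G (\<i> * (- \<i> * z))) \<le> M'"
        proof (rule phragmen_lindelof_quadrant[where f = "\<lambda>z. G (\<i> * z)" and w = "- \<i> * z"])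
          show "(\<lambda>z. G (\<i> * z)) holomorphic_on UNIV"
            using holomorphic_on_compose_gen[of "\<lambda>z. \<i> * z" UNIV G UNIV] G_hol
            by (simp add: o_def holomorphic_intros)
          show "cmod (G (\<i> * z)) \<le> A * exp ((B + \<epsilon>) * cmod z)" for z
            using G_type[of "\<i> * z"] by (simp add: norm_mult)
          show "cmod (G (\<i> * (\<i> * of_real t))) \<le> M'" for t
            using G_real[of "-t"] by (simp flip: mult.assoc)
        qed (use \<open>M' > 0\<close> G_imag 3 that in auto)
        then show ?thesis by (simp flip: mult.assoc)
      qed
    qed
    have closure_H: "closure {z. 0 < Im z} \<subseteq> {z. 0 \<le> Im z}"
      by (rule closure_minimal) (auto intro!: closed_Collect_le continuous_intros)
    have closure_H': "0 \<le> Im z" if "z \<in> closure {z. 0 < Im z}" for z using closure_H that by auto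
    have "open {z. 0 < Im z}" by (auto intro!: open_Collect_less continuous_intros)
    have norm_ge: "1 \<le> cmod (1 - \<i> * z)" if "0 \<le> Im z" for z
      using abs_Re_le_cmod[of "1 - \<i> * z"] that by simp
    have "cmod (G w) \<le> M"
    proof (rule phragmen_lindelof_principle[where f = G and w = w and S = "{z. 0 < Im z}" and P = "\<lambda>z. Ln (1 - \<i> * z)"])
      show "G holomorphic_on {z. 0 < Im z}" by (rule holomorphic_on_subset[OF G_hol]) auto
      show "continuous_on (closure {z. 0 < Im z}) G"
        by (rule holomorphic_on_imp_continuous_on, rule holomorphic_on_subset[OF G_hol]) auto
      have Ln_hol: "(\<lambda>z. Ln (1 - \<i> * z)) holomorphic_on {z. -1 < Im z}"
        by (intro holomorphic_intros) (auto simp: complex_nonpos_Reals_iff)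
      have sub: "closure {z. 0 < Im z} \<subseteq> {z. -1 < Im z}"
        using closure_H by fastforce
      show "(\<lambda>z. Ln (1 - \<i> * z)) holomorphic_on {z. 0 < Im z}"
        by (rule holomorphic_on_subset[OF Ln_hol]) auto
      show "continuous_on (closure {z. 0 < Im z}) (\<lambda>z. Ln (1 - \<i> * z))"
        by (rule holomorphic_on_imp_continuous_on, rule holomorphic_on_subset[OF Ln_hol sub])
      show "0 \<le> Re (Ln (1 - \<i> * z))" if "z \<in> closure {z. 0 < Im z}" for z
        using norm_ge[OF closure_H'[OF that]] by (subst Re_Ln) auto
      show "cmod (G z) \<le> M" if "z \<in> frontier {z. 0 < Im z}" for z
      proof -
        have "Im z = 0" using that \<open>open {z. 0 < Im z}\<close> closure_H
          by (auto simp: frontier_def interior_open)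
        then have "z = of_real (Re z)" by (simp add: complex_eq_iff)
        then show ?thesis using real_axis[of "Re z"] \<open>Im z = 0\<close> by (simp add: norm_G)
      qed
      show "\<exists>R. \<forall>z\<in>closure {z. 0 < Im z}. R \<le> cmod z \<longrightarrow>
          cmod (G z) * exp (- (\<delta> * Re (Ln (1 - \<i> * z)))) \<le> M" if "\<delta> > 0" for \<delta>
      proof -
        have "((\<lambda>x::real. M' * exp (- (\<delta> * ln (x - 1)))) \<longlongrightarrow> 0) at_top"
        proof -
          have "((\<lambda>x::real. exp (- (\<delta> * ln (x - 1)))) \<longlongrightarrow> 0) at_top"
            using \<open>\<delta> > 0\<close> by real_asymp
          from tendsto_mult_left[OF this, of M'] show ?thesis by simp
        qed
        then have "eventually (\<lambda>x. M' * exp (- (\<delta> * ln (x - 1))) < M) at_top"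
          using \<open>M > 0\<close> by (rule order_tendstoD)
        then obtain R where R: "\<And>x. x \<ge> R \<Longrightarrow> M' * exp (- (\<delta> * ln (x - 1))) < M"
          by (auto simp: eventually_at_top_linorder)
        show ?thesis
        proof (intro exI[of _ "max R 2"] ballI impI)
          fix z assume z: "z \<in> closure {z. 0 < Im z}" "max R 2 \<le> cmod z"
          have "cmod z - 1 \<le> cmod (1 - \<i> * z)"
            using norm_triangle_ineq2[of "\<i> * z" 1] by (simp add: norm_mult norm_minus_commute)
          moreover have "cmod (1 - \<i> * z) \<ge> 1" using norm_ge closure_H' z(1) by auto
          moreover from this have "1 - \<i> * z \<noteq> 0" by auto
          ultimately have "ln (cmod z - 1) \<le> Re (Ln (1 - \<i> * z))"
            using z(2) by (simp add: ln_le_cancel_iff del: right_minus_eq)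
          then have E: "exp (- (\<delta> * Re (Ln (1 - \<i> * z)))) \<le> exp (- (\<delta> * ln (cmod z - 1)))"
            using \<open>\<delta> > 0\<close> by simp
          have "cmod (G z) \<le> M'"
          proof (cases "Im z = 0")
            case True
            then have "z = of_real (Re z)" by (simp add: complex_eq_iff)
            then show ?thesis using G_real by metis
          qed (use G_bounded closure_H'[OF z(1)] in auto)
          then have "cmod (G z) * exp (- (\<delta> * Re (Ln (1 - \<i> * z)))) \<le> M' * exp (- (\<delta> * ln (cmod z - 1)))"
            using E \<open>M' > 0\<close> by (intro mult_mono) auto
          also have "\<dots> \<le> M" using R[of "cmod z"] z(2) by simp
          finally show "cmod (G z) * exp (- (\<delta> * Re (Ln (1 - \<i> * z)))) \<le> M" .
        qed
      qed
    qed (use \<open>M > 0\<close> \<open>0 < Im w\<close> \<open>open {z. 0 < Im z}\<close> in auto)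
    then show ?thesis by (simp add: norm_G)
  qed
  have "((\<lambda>\<epsilon>. cmod (f w) * exp (- (\<epsilon> * Im w))) \<longlongrightarrow> cmod (f w) * exp (- (0 * Im w))) (at_right 0)"
    by (intro tendsto_intros)
  then show ?thesis
    using bound by (intro tendsto_upperbound[where F = "at_right 0"])
      (auto intro: eventually_mono[OF eventually_at_right_less])
qed

section \<open>Integrals of exponentials of linear forms\<close>

lemma norm_exp_minus_linear_le: "cmod (exp b - 1 - b) \<le> (cmod b)\<^sup>2 * exp (cmod b)"
  using Taylor_exp_field[of b 1] by (simp add: algebra_simps power2_eq_square)

lemma norm_integral_le_integral:
  fixes f :: "'m \<Rightarrow> complex"
  assumes "integrable M f" "integrable M g" "\<And>y. norm (f y) \<le> g y"
  shows "norm (\<integral>y. f y \<partial>M) \<le> (\<integral>y. g y \<partial>M)"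
proof -
  have "norm (\<integral>y. f y \<partial>M) \<le> (\<integral>y. norm (f y) \<partial>M)" by (rule integral_norm_bound)
  also have "\<dots> \<le> (\<integral>y. g y \<partial>M)"
    using assms by (intro integral_mono) auto
  finally show ?thesis .
qed

text \<open>Fourier--Laplace transforms are differentiated under the integral sign by the Taylor estimate
\<open>norm_exp_minus_linear_le\<close>, whose remainder is quadratic uniformly in \<open>y\<close>. The number \<open>n y\<close>
bounds the operator norm of the linear form \<open>l _ y\<close>. The same statement serves for one complex
variable on a half-plane and for several complex variables with frequencies in a cube.\<close>

lemma has_derivative_integral_exp_linear:
  fixes l :: "'x::real_normed_vector \<Rightarrow> 'm \<Rightarrow> complex" and g :: "'m \<Rightarrow> complex"
  assumes g: "integrable M g"
    and lin: "\<And>y. linear (\<lambda>v. l v y)"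
    and meas [measurable]: "\<And>v. l v \<in> borel_measurable M"
    and l_le: "\<And>v y. cmod (l v y) \<le> n y * norm v" and n: "\<And>y. 0 \<le> n y"
    and "r > 0"
    and dom: "\<And>y. g y \<noteq> 0 \<Longrightarrow> cmod (exp (l z y)) * (1 + n y)\<^sup>2 * exp (r * n y) \<le> C"
  shows "((\<lambda>x. \<integral>y. g y * exp (l x y) \<partial>M) has_derivative
    (\<lambda>v. \<integral>y. g y * exp (l z y) * l v y \<partial>M)) (at z)"
proof -
  have [measurable]: "g \<in> borel_measurable M" using g by auto
  have l_add: "l (v + w) y = l v y + l w y" for v w y using linear_add[OF lin] .
  have l_scale: "l (c *\<^sub>R v) y = c *\<^sub>R l v y" for c v y using linear_scale[OF lin] .
  have Cg: "integrable M (\<lambda>y. C * cmod (g y))" using g by simp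
  \<comment> \<open>The domination hypothesis bundles the bounds for the integrand near \<open>z\<close>, for its first
    derivative, and for the quadratic remainder.\<close>
  have E: "cmod (exp (l z y)) * exp (r * n y) \<le> C"
    "cmod (exp (l z y)) * n y \<le> C"
    "cmod (exp (l z y)) * (n y)\<^sup>2 * exp (r * n y) \<le> C" if "g y \<noteq> 0" for y
  proof -
    have "1 \<le> exp (r * n y)" using n \<open>r > 0\<close> by simp
    have sq: "1 \<le> (1 + n y)\<^sup>2" "n y \<le> (1 + n y)\<^sup>2" "(n y)\<^sup>2 \<le> (1 + n y)\<^sup>2"
      using n[of y] by (auto simp: power2_eq_square algebra_simps)
    have "cmod (exp (l z y)) * 1 * exp (r * n y) \<le> cmod (exp (l z y)) * (1 + n y)\<^sup>2 * exp (r * n y)"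
      using sq by (intro mult_right_mono mult_left_mono) auto
    from order_trans[OF this dom[OF that]] show "cmod (exp (l z y)) * exp (r * n y) \<le> C"
      by (simp del: norm_exp_eq_Re)
    have "cmod (exp (l z y)) * (n y)\<^sup>2 * exp (r * n y) \<le> cmod (exp (l z y)) * (1 + n y)\<^sup>2 * exp (r * n y)"
      using sq by (intro mult_right_mono mult_left_mono) auto
    from order_trans[OF this dom[OF that]] show "cmod (exp (l z y)) * (n y)\<^sup>2 * exp (r * n y) \<le> C" .
    have "cmod (exp (l z y)) * n y * 1 \<le> cmod (exp (l z y)) * (1 + n y)\<^sup>2 * exp (r * n y)"
      using sq n \<open>1 \<le> exp (r * n y)\<close> by (intro mult_mono) auto
    from order_trans[OF this dom[OF that]] show "cmod (exp (l z y)) * n y \<le> C"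
      by (simp del: norm_exp_eq_Re)
  qed
  have int_deriv: "integrable M (\<lambda>y. g y * exp (l z y) * l v y)" for v
  proof (rule Bochner_Integration.integrable_bound)
    show "integrable M (\<lambda>y. norm v * (C * cmod (g y)))" using Cg by simp
    have "cmod (g y * exp (l z y) * l v y) \<le> norm v * (C * cmod (g y))" for y
    proof (cases "g y = 0")
      case False
      have "cmod (exp (l z y)) * cmod (l v y) \<le> cmod (exp (l z y)) * (n y * norm v)"
        by (intro mult_left_mono l_le) auto
      also have "\<dots> \<le> C * norm v"
        using mult_right_mono[OF E(2)[OF False], of "norm v"] by (simp add: mult.assoc)
      finally have "cmod (g y) * (cmod (exp (l z y)) * cmod (l v y)) \<le> cmod (g y) * (C * norm v)"
        by (intro mult_left_mono) auto
      then show ?thesis by (simp add: norm_mult algebra_simps)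
    qed auto
    then show "AE y in M. norm (g y * exp (l z y) * l v y) \<le> norm (norm v * (C * cmod (g y)))"
      by (auto intro!: AE_I2 order_trans[OF _ abs_ge_self])
  qed measurable
  have int_exp: "integrable M (\<lambda>y. g y * exp (l (z + h) y))" if "norm h \<le> r" for h
  proof (rule Bochner_Integration.integrable_bound[OF Cg])
    have "cmod (g y * exp (l (z + h) y)) \<le> C * cmod (g y)" for y
    proof (cases "g y = 0")
      case False
      have "cmod (exp (l h y)) \<le> exp (cmod (l h y))" by (rule norm_exp)
      also have "\<dots> \<le> exp (r * n y)"
        using l_le[of h y] mult_left_mono[OF that n[of y]] by (simp add: mult.commute)
      finally have "cmod (exp (l z y)) * cmod (exp (l h y)) \<le> cmod (exp (l z y)) * exp (r * n y)"
        by (intro mult_left_mono) auto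
      also have "\<dots> \<le> C" using E(1)[OF False] .
      finally have "cmod (g y) * (cmod (exp (l z y)) * cmod (exp (l h y))) \<le> cmod (g y) * C"
        by (intro mult_left_mono) auto
      then show ?thesis by (simp only: l_add exp_add norm_mult mult.commute)
    qed auto
    then show "AE y in M. norm (g y * exp (l (z + h) y)) \<le> norm (C * cmod (g y))"
      by (auto intro!: AE_I2 order_trans[OF _ abs_ge_self])
  qed measurable
  define F where "F x = (\<integral>y. g y * exp (l x y) \<partial>M)" for x
  define D where "D v = (\<integral>y. g y * exp (l z y) * l v y \<partial>M)" for v
  define K where "K = (\<integral>y. C * cmod (g y) \<partial>M)"
  have remainder: "cmod (F (z + h) - F z - D h) \<le> K * (norm h)\<^sup>2" if h: "norm h \<le> r" for h
  proof -
    have [simp]: "integrable M (\<lambda>y. g y * exp (l z y))"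
      using int_exp[of 0] \<open>r > 0\<close> by simp
    have "F (z + h) - F z - D h = (\<integral>y. g y * exp (l (z + h) y) - g y * exp (l z y) - g y * exp (l z y) * l h y \<partial>M)"
      unfolding F_def D_def using int_exp[OF h] int_deriv by simp
    also have "cmod \<dots> \<le> (\<integral>y. (norm h)\<^sup>2 * (C * cmod (g y)) \<partial>M)"
    proof (rule norm_integral_le_integral)
      fix y
      show "cmod (g y * exp (l (z + h) y) - g y * exp (l z y) - g y * exp (l z y) * l h y) \<le> (norm h)\<^sup>2 * (C * cmod (g y))"
      proof (cases "g y = 0")
        case False
        define b where "b = l h y"
        have b1: "cmod b \<le> n y * norm h" by (simp add: b_def l_le)
        then have b2: "cmod b \<le> r * n y" using mult_left_mono[OF h n[of y]] by (simp add: mult.commute)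
        have "cmod (exp b - 1 - b) \<le> (cmod b)\<^sup>2 * exp (cmod b)" by (rule norm_exp_minus_linear_le)
        also have "\<dots> \<le> (n y * norm h)\<^sup>2 * exp (r * n y)"
          using b1 b2 by (intro mult_mono power_mono) auto
        finally have "cmod (exp (l z y)) * cmod (exp b - 1 - b) \<le> cmod (exp (l z y)) * ((n y * norm h)\<^sup>2 * exp (r * n y))"
          by (intro mult_left_mono) auto
        also have "\<dots> = cmod (exp (l z y)) * (n y)\<^sup>2 * exp (r * n y) * (norm h)\<^sup>2"
          by (simp add: power_mult_distrib algebra_simps)
        also have "\<dots> \<le> C * (norm h)\<^sup>2" using E(3)[OF False] by (intro mult_right_mono) auto
        finally have "cmod (g y) * (cmod (exp (l z y)) * cmod (exp b - 1 - b)) \<le> cmod (g y) * (C * (norm h)\<^sup>2)"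
          by (intro mult_left_mono) auto
        moreover have "g y * exp (l (z + h) y) - g y * exp (l z y) - g y * exp (l z y) * l h y = g y * (exp (l z y) * (exp b - 1 - b))"
          by (simp add: l_add exp_add b_def algebra_simps)
        ultimately show ?thesis by (simp only: norm_mult mult.commute mult.left_commute)
      qed auto
    qed (use int_exp[OF h] int_deriv Cg in auto)
    also have "\<dots> = K * (norm h)\<^sup>2" by (simp add: K_def)
    finally show ?thesis .
  qed
  have "(F has_derivative D) (at z)"
  proof (rule has_derivativeI_sandwich[OF \<open>r > 0\<close>])
    show "bounded_linear D"
    proof (rule bounded_linear_intro)
      show "D (v + w) = D v + D w" for v w
        unfolding D_def by (simp add: l_add distrib_left int_deriv)
      show "D (c *\<^sub>R v) = c *\<^sub>R D v" for c v
        unfolding D_def using int_deriv[of v] by (simp add: l_scale)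
      show "cmod (D v) \<le> norm v * K" for v
      proof -
        have "cmod (D v) \<le> (\<integral>y. norm v * (C * cmod (g y)) \<partial>M)"
          unfolding D_def
        proof (rule norm_integral_le_integral)
          fix y
          show "cmod (g y * exp (l z y) * l v y) \<le> norm v * (C * cmod (g y))"
          proof (cases "g y = 0")
            case False
            have "cmod (exp (l z y)) * cmod (l v y) \<le> cmod (exp (l z y)) * (n y * norm v)"
              by (intro mult_left_mono l_le) auto
            also have "\<dots> \<le> C * norm v"
              using mult_right_mono[OF E(2)[OF False], of "norm v"] by (simp add: mult.assoc)
            finally have "cmod (g y) * (cmod (exp (l z y)) * cmod (l v y)) \<le> cmod (g y) * (C * norm v)"
              by (intro mult_left_mono) auto
            then show ?thesis by (simp add: norm_mult algebra_simps)
          qed auto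
        qed (use int_deriv Cg in auto)
        then show ?thesis by (simp add: K_def)
      qed
    qed
    show "norm (F x - F z - D (x - z)) / norm (x - z) \<le> K * norm (x - z)"
      if "x \<noteq> z" "dist x z < r" for x
    proof -
      have "norm (F x - F z - D (x - z)) \<le> K * (norm (x - z))\<^sup>2"
        using remainder[of "x - z"] that by (simp add: dist_norm)
      then show ?thesis using that by (simp add: divide_le_eq power2_eq_square mult.assoc)
    qed
    have "((\<lambda>x. K * norm (x - z)) \<longlongrightarrow> K * norm (z - z)) (at z)" by (intro tendsto_intros)
    then show "((\<lambda>x. K * norm (x - z)) \<longlongrightarrow> 0) (at z)" by simp
  qed
  then show "((\<lambda>x. \<integral>y. g y * exp (l x y) \<partial>M) has_derivative
        (\<lambda>v. \<integral>y. g y * exp (l z y) * l v y \<partial>M)) (at z)"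
    unfolding F_def D_def .
qed

text \<open>Transforms with nonnegative frequencies \<open>v\<close>: the exponential has modulus at most \<open>1\<close> on the
closed upper half-plane and decays there with the imaginary part, which dominates every polynomial in
\<open>v\<close>.\<close>

context
  fixes M :: "'m measure" and k :: "'m \<Rightarrow> complex" and v :: "'m \<Rightarrow> real"
  assumes k: "integrable M k" and v [measurable]: "v \<in> borel_measurable M"
    and v_nonneg: "\<And>y. k y \<noteq> 0 \<Longrightarrow> 0 \<le> v y"
begin

lemma upper_transform_norm_le_pointwise:
  assumes "0 \<le> Im w"
  shows "cmod (k y * exp (\<i> * w * of_real (v y))) \<le> cmod (k y)"
proof (cases "k y = 0")
  case False
  then have "0 \<le> Im w * v y" using assms v_nonneg by simp
  then show ?thesis by (simp add: norm_mult mult_left_le)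
qed auto

lemma upper_transform_integrable:
  assumes "0 \<le> Im w"
  shows "integrable M (\<lambda>y. k y * exp (\<i> * w * of_real (v y)))"
  using upper_transform_norm_le_pointwise[OF assms] k
  by (intro Bochner_Integration.integrable_bound[OF k]) auto

lemma upper_transform_norm_le:
  assumes "0 \<le> Im w"
  shows "cmod (\<integral>y. k y * exp (\<i> * w * of_real (v y)) \<partial>M) \<le> (\<integral>y. cmod (k y) \<partial>M)"
proof (rule norm_integral_le_integral)
  show "integrable M (\<lambda>y. k y * exp (\<i> * w * of_real (v y)))"
    by (rule upper_transform_integrable[OF assms])
qed (use upper_transform_norm_le_pointwise[OF assms] k in auto)

lemma upper_transform_continuous:
  "continuous_on {w. 0 \<le> Im w} (\<lambda>w. \<integral>y. k y * exp (\<i> * w * of_real (v y)) \<partial>M)"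
  unfolding continuous_on_sequentially o_def
proof (intro allI ballI impI)
  fix x :: "nat \<Rightarrow> complex" and a
  assume x: "(\<forall>n. x n \<in> {w. 0 \<le> Im w}) \<and> x \<longlonglongrightarrow> a"
  show "(\<lambda>n. \<integral>y. k y * exp (\<i> * x n * of_real (v y)) \<partial>M)
      \<longlonglongrightarrow> (\<integral>y. k y * exp (\<i> * a * of_real (v y)) \<partial>M)"
  proof (rule integral_dominated_convergence[where w = "\<lambda>y. cmod (k y)"])
    show "AE y in M. (\<lambda>n. k y * exp (\<i> * x n * of_real (v y))) \<longlonglongrightarrow> k y * exp (\<i> * a * of_real (v y))"
      using x by (intro AE_I2 tendsto_intros) auto
    show "AE y in M. norm (k y * exp (\<i> * x n * of_real (v y))) \<le> cmod (k y)" for n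
      using x by (intro AE_I2 upper_transform_norm_le_pointwise) auto
  qed (use k in \<open>auto intro!: borel_measurable_times borel_measurable_continuous_onI[THEN measurable_compose_rev] \<close>)
qed

lemma upper_transform_holomorphic:
  "(\<lambda>w. \<integral>y. k y * exp (\<i> * w * of_real (v y)) \<partial>M) holomorphic_on {w. 0 < Im w}"
proof -
  have "\<exists>D. ((\<lambda>w. \<integral>y. k y * exp (\<i> * w * of_real (v y)) \<partial>M) has_field_derivative D) (at z)"
    if "0 < Im z" for z
  proof -
    define c where "c = Im z / 2"
    have "c > 0" using that by (simp add: c_def)
    \<comment> \<open>Half of the decay \<open>exp (- v * Im z)\<close> pays for moving \<open>z\<close> by \<open>c\<close>, the other half for the
      polynomial factor.\<close>
    have dom: "cmod (exp (\<i> * z * of_real (v y))) * (1 + \<bar>v y\<bar>)\<^sup>2 * exp (c * \<bar>v y\<bar>) \<le> (1 + 2 / c)\<^sup>2"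
      if "k y \<noteq> 0" for y
    proof -
      have "0 \<le> v y" using v_nonneg[OF that] .
      have "1 + c * v y / 2 \<le> exp (c * v y / 2)" by (rule exp_ge_add_one_self)
      moreover have "1 \<le> exp (c * v y / 2)" using \<open>0 \<le> v y\<close> \<open>c > 0\<close> by simp
      ultimately have "v y \<le> 2 / c * exp (c * v y / 2)" "1 \<le> exp (c * v y / 2)"
        using \<open>c > 0\<close> by (simp_all add: field_simps)
      then have "1 + v y \<le> exp (c * v y / 2) + 2 / c * exp (c * v y / 2)" by linarith
      then have "1 + v y \<le> (1 + 2 / c) * exp (c * v y / 2)" by (simp only: distrib_right mult_1_left)
      then have "(1 + v y)\<^sup>2 \<le> ((1 + 2 / c) * exp (c * v y / 2))\<^sup>2"
        using \<open>0 \<le> v y\<close> by (intro power_mono) auto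
      also have "\<dots> = (1 + 2 / c)\<^sup>2 * exp (c * v y)"
        by (simp add: power_mult_distrib flip: exp_double)
      finally have sq: "(1 + v y)\<^sup>2 \<le> (1 + 2 / c)\<^sup>2 * exp (c * v y)" .
      have "cmod (exp (\<i> * z * of_real (v y))) * (1 + \<bar>v y\<bar>)\<^sup>2 * exp (c * \<bar>v y\<bar>)
          = exp (- (2 * c * v y)) * (1 + v y)\<^sup>2 * exp (c * v y)"
        using \<open>0 \<le> v y\<close> by (simp add: c_def)
      also have "\<dots> \<le> exp (- (2 * c * v y)) * ((1 + 2 / c)\<^sup>2 * exp (c * v y)) * exp (c * v y)"
        using sq by (intro mult_right_mono mult_left_mono) auto
      also have "\<dots> = (1 + 2 / c)\<^sup>2 * exp (- (2 * c * v y) + c * v y + c * v y)"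
        unfolding exp_add by (simp add: algebra_simps)
      also have "\<dots> = (1 + 2 / c)\<^sup>2" by simp
      finally show ?thesis .
    qed
    have "((\<lambda>w. \<integral>y. k y * exp (\<i> * w * of_real (v y)) \<partial>M) has_derivative
        (\<lambda>h. \<integral>y. k y * exp (\<i> * z * of_real (v y)) * (\<i> * h * of_real (v y)) \<partial>M)) (at z)"
    proof (rule has_derivative_integral_exp_linear[where n = "\<lambda>y. \<bar>v y\<bar>" and r = c and C = "(1 + 2 / c)\<^sup>2"])
      show "linear (\<lambda>h. \<i> * h * of_real (v y))" for y
        by (rule linearI) (simp_all add: algebra_simps)
    qed (use k \<open>c > 0\<close> dom in \<open>auto simp: norm_mult\<close>)
    also have "(\<lambda>h. \<integral>y. k y * exp (\<i> * z * of_real (v y)) * (\<i> * h * of_real (v y)) \<partial>M)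
        = (*) (\<integral>y. k y * exp (\<i> * z * of_real (v y)) * (\<i> * of_real (v y)) \<partial>M)"
    proof
      fix h
      have "(\<integral>y. k y * exp (\<i> * z * of_real (v y)) * (\<i> * h * of_real (v y)) \<partial>M)
          = (\<integral>y. k y * exp (\<i> * z * of_real (v y)) * (\<i> * of_real (v y)) * h \<partial>M)"
        by (simp only: mult_ac)
      then show "(\<integral>y. k y * exp (\<i> * z * of_real (v y)) * (\<i> * h * of_real (v y)) \<partial>M)
          = (\<integral>y. k y * exp (\<i> * z * of_real (v y)) * (\<i> * of_real (v y)) \<partial>M) * h"
        by (simp only: integral_mult_left_zero)
    qed
    finally show ?thesis unfolding has_field_derivative_def by blast
  qed
  then show ?thesis
    by (subst holomorphic_on_open) (auto intro!: open_Collect_less continuous_intros)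
qed

lemma upper_transform_tendsto_zero:
  assumes "\<And>y. k y \<noteq> 0 \<Longrightarrow> 0 < v y"
  shows "(\<lambda>n. \<integral>y. k y * exp (\<i> * (\<i> * of_nat n) * of_real (v y)) \<partial>M) \<longlonglongrightarrow> 0"
proof -
  have "(\<lambda>n. \<integral>y. k y * exp (\<i> * (\<i> * of_nat n) * of_real (v y)) \<partial>M) \<longlonglongrightarrow> (\<integral>y. 0 \<partial>M)"
  proof (rule integral_dominated_convergence[where w = "\<lambda>y. cmod (k y)"])
    show "AE y in M. (\<lambda>n. k y * exp (\<i> * (\<i> * of_nat n) * of_real (v y))) \<longlonglongrightarrow> 0"
    proof (rule AE_I2)
      fix y
      show "(\<lambda>n. k y * exp (\<i> * (\<i> * of_nat n) * of_real (v y))) \<longlonglongrightarrow> 0"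
      proof (cases "k y = 0")
        case False
        then have "0 < v y" by (rule assms)
        have "(\<lambda>n. exp (- v y) ^ n) \<longlonglongrightarrow> 0"
          using \<open>0 < v y\<close> by (intro LIMSEQ_realpow_zero) auto
        moreover have "cmod (exp (\<i> * (\<i> * of_nat n) * of_real (v y))) = exp (- v y) ^ n" for n
          by (simp add: mult.assoc[symmetric] exp_of_nat_mult[symmetric])
        ultimately have "(\<lambda>n. exp (\<i> * (\<i> * of_nat n) * of_real (v y))) \<longlonglongrightarrow> 0"
          by (subst tendsto_norm_zero_iff[symmetric]) simp
        from tendsto_mult_left[OF this, of "k y"] show ?thesis by simp
      qed auto
    qed
    show "AE y in M. norm (k y * exp (\<i> * (\<i> * of_nat n) * of_real (v y))) \<le> cmod (k y)" for n
      by (intro AE_I2 upper_transform_norm_le_pointwise) auto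
  qed (use k in auto)
  then show ?thesis by simp
qed

end

section \<open>Spectrum of a function of exponential type on a line\<close>

text \<open>The one-variable heart of the Paley--Wiener theorem, in a form that needs no inversion formula: the
frequencies \<open>u\<close> live on an arbitrary measure space, so the remaining variables of a function on
\<open>d\<close>-space can be absorbed into \<open>g\<close> without disintegrating it.\<close>

lemma spectrum_above_type_vanishes:
  fixes g :: "'m \<Rightarrow> complex" and u :: "'m \<Rightarrow> real"
  assumes g: "integrable M g" and u [measurable]: "u \<in> borel_measurable M"
    and h: "h holomorphic_on UNIV" and type: "exponential_type_le \<sigma> h"
    and h_real: "\<And>t. h (of_real t) = (\<integral>y. g y * exp (- \<i> * of_real (t * u y)) \<partial>M)"
  shows "(\<integral>y. (if \<sigma> < u y then g y else 0) * exp (- \<i> * of_real (t * u y)) \<partial>M) = 0"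
proof -
  have [measurable]: "g \<in> borel_measurable M" using g by auto
  define hi where "hi y = (if \<sigma> < u y then g y else 0)" for y
  define lo where "lo y = (if \<sigma> < u y then 0 else g y)" for y
  have hi_int: "integrable M hi" unfolding hi_def
    by (rule Bochner_Integration.integrable_bound[OF g]) auto
  have lo_int: "integrable M lo" unfolding lo_def
    by (rule Bochner_Integration.integrable_bound[OF g]) auto
  \<comment> \<open>Multiplying by \<open>exp (\<i> * \<sigma> * w)\<close> shifts the frequencies by \<open>\<sigma>\<close>. The low part then extends
    to the upper half-plane; the high part is written as a transform on the upper half-plane
    composed with \<open>uminus\<close>.\<close>
  define L where "L w = (\<integral>y. lo y * exp (\<i> * w * of_real (\<sigma> - u y)) \<partial>M)" for w
  define H where "H w = (\<integral>y. hi y * exp (\<i> * w * of_real (u y - \<sigma>)) \<partial>M)" for w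
  have lo_m: "(\<lambda>y. \<sigma> - u y) \<in> borel_measurable M" and hi_m: "(\<lambda>y. u y - \<sigma>) \<in> borel_measurable M"
    by measurable
  have lo_pos: "0 \<le> \<sigma> - u y" if "lo y \<noteq> 0" for y
    using that by (auto simp: lo_def split: if_splits)
  have hi_pos: "0 < u y - \<sigma>" if "hi y \<noteq> 0" for y
    using that by (auto simp: hi_def split: if_splits)
  note hi_nonneg = less_imp_le[OF hi_pos]
  note L_lemmas = upper_transform_integrable[OF lo_int lo_m lo_pos]
    upper_transform_norm_le[OF lo_int lo_m lo_pos, folded L_def]
    upper_transform_continuous[OF lo_int lo_m lo_pos, folded L_def]
    upper_transform_holomorphic[OF lo_int lo_m lo_pos, folded L_def]
  note H_lemmas = upper_transform_integrable[OF hi_int hi_m hi_nonneg]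
    upper_transform_norm_le[OF hi_int hi_m hi_nonneg, folded H_def]
    upper_transform_continuous[OF hi_int hi_m hi_nonneg, folded H_def]
    upper_transform_holomorphic[OF hi_int hi_m hi_nonneg, folded H_def]
    upper_transform_tendsto_zero[OF hi_int hi_m hi_nonneg hi_pos, folded H_def]
  define G where "G w = h w * exp (\<i> * of_real \<sigma> * w)" for w
  have G_hol: "G holomorphic_on UNIV" unfolding G_def using h by (intro holomorphic_intros)
  then have G_cont: "continuous_on UNIV G" by (rule holomorphic_on_imp_continuous_on)
  have G_real: "G (of_real t) = L (of_real t) + H (- of_real t)" for t
  proof -
    have "G (of_real t) = (\<integral>y. g y * exp (- \<i> * of_real (t * u y)) * exp (\<i> * of_real \<sigma> * of_real t) \<partial>M)"
      unfolding G_def h_real by simp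
    also have "\<dots> = (\<integral>y. lo y * exp (\<i> * of_real t * of_real (\<sigma> - u y)) +
        hi y * exp (\<i> * (- of_real t) * of_real (u y - \<sigma>)) \<partial>M)"
      by (intro Bochner_Integration.integral_cong)
        (auto simp: lo_def hi_def algebra_simps simp flip: exp_add)
    also have "\<dots> = L (of_real t) + H (- of_real t)"
      unfolding L_def H_def by (intro Bochner_Integration.integral_add L_lemmas(1) H_lemmas(1)) auto
    finally show ?thesis .
  qed
  define B where "B = 1 + (\<integral>y. cmod (g y) \<partial>M)"
  have "0 \<le> (\<integral>y. cmod (g y) \<partial>M)" by simp
  then have "B > 0" unfolding B_def by linarith
  have "cmod (h (of_real t)) \<le> (\<integral>y. cmod (g y) \<partial>M)" for t
    unfolding h_real by (rule order_trans[OF integral_norm_bound]) (simp add: norm_mult)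
  then have G_le_real: "cmod (G (of_real t)) \<le> B" for t
    by (simp add: G_def norm_mult B_def add_increasing)
  have exp_le: "cmod (exp (\<i> * of_real \<sigma> * w)) \<le> exp (\<bar>\<sigma>\<bar> * cmod w)" for w
  proof -
    have "cmod (exp (\<i> * of_real \<sigma> * w)) \<le> exp (cmod (\<i> * of_real \<sigma> * w))" by (rule norm_exp)
    then show ?thesis by (simp add: norm_mult)
  qed
  obtain C where C: "\<And>w. cmod (h w) \<le> C * exp ((\<sigma> + 1) * cmod w)"
    using type unfolding exponential_type_le_def by (meson zero_less_one)
  have G_type: "cmod (G w) \<le> C * exp ((\<sigma> + 1 + \<bar>\<sigma>\<bar>) * cmod w)" for w
  proof -
    have "cmod (G w) \<le> (C * exp ((\<sigma> + 1) * cmod w)) * exp (\<bar>\<sigma>\<bar> * cmod w)"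
      unfolding G_def norm_mult
      using C[of w] exp_le[of w] by (intro mult_mono) (auto intro: order_trans[OF norm_ge_zero])
    then show ?thesis by (simp add: exp_add distrib_right)
  qed
  have G_imag: "\<exists>C. \<forall>t\<ge>0. cmod (G (\<i> * of_real t)) \<le> C * exp (\<epsilon> * t)" if "\<epsilon> > 0" for \<epsilon>
  proof -
    obtain C where C: "\<And>w. cmod (h w) \<le> C * exp ((\<sigma> + \<epsilon>) * cmod w)"
      using type \<open>\<epsilon> > 0\<close> unfolding exponential_type_le_def by meson
    have "cmod (G (\<i> * of_real t)) \<le> C * exp (\<epsilon> * t)" if "t \<ge> 0" for t
    proof -
      have "cmod (G (\<i> * of_real t)) = cmod (h (\<i> * of_real t)) * exp (- (\<sigma> * t))"
        by (simp add: G_def norm_mult)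
      also have "\<dots> \<le> C * exp ((\<sigma> + \<epsilon>) * t) * exp (- (\<sigma> * t))"
        using C[of "\<i> * of_real t"] that by (intro mult_right_mono) (auto simp: norm_mult)
      also have "\<dots> = C * exp (\<epsilon> * t)"
        by (simp add: mult.assoc distrib_right flip: exp_add)
      finally show ?thesis .
    qed
    then show ?thesis by blast
  qed
  have G_le: "cmod (G w) \<le> B" if "0 \<le> Im w" for w
    by (rule phragmen_lindelof_half_plane[OF G_hol G_type \<open>B > 0\<close> G_le_real G_imag that])
  \<comment> \<open>Both branches agree on the real line, where they are the high-frequency part.\<close>
  define Q where "Q w = (if Im w \<le> 0 then H (- w) else G w - L w)" for w
  have "Q holomorphic_on UNIV"
  proof (rule holomorphic_on_paste_across_line[where d = \<i> and k = 0])
    have "(\<lambda>w. H (- w)) holomorphic_on {w. Im w < 0}"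
      using holomorphic_on_compose_gen[OF holomorphic_on_minus[OF holomorphic_on_ident] H_lemmas(4), of "{w. Im w < 0}"]
      by (simp add: o_def image_subset_iff)
    then have "Q holomorphic_on {w. Im w < 0}"
      by (rule holomorphic_transform) (auto simp: Q_def)
    then show "Q holomorphic_on UNIV \<inter> {z. \<i> \<bullet> z < 0}"
      by (simp add: inner_complex_def)
    have "(\<lambda>w. G w - L w) holomorphic_on {w. 0 < Im w}"
      using holomorphic_on_subset[OF G_hol] L_lemmas(4) by (intro holomorphic_intros) auto
    then have "Q holomorphic_on {w. 0 < Im w}"
      by (rule holomorphic_transform) (auto simp: Q_def)
    then show "Q holomorphic_on UNIV \<inter> {z. 0 < \<i> \<bullet> z}"
      by (simp add: inner_complex_def)
    have "continuous_on ({w. Im w \<le> 0} \<union> {w. 0 \<le> Im w}) Q"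
      unfolding Q_def
    proof (rule continuous_on_cases)
      show "closed {w. Im w \<le> 0}" "closed {w. 0 \<le> Im w}"
        by (auto intro!: closed_Collect_le continuous_intros)
      show "continuous_on {w. Im w \<le> 0} (\<lambda>w. H (- w))"
        by (rule continuous_on_compose2[OF H_lemmas(3)]) (auto intro!: continuous_intros)
      show "continuous_on {w. 0 \<le> Im w} (\<lambda>w. G w - L w)"
        by (intro continuous_on_diff L_lemmas(3) continuous_on_subset[OF G_cont]) auto
      have "H (- w) = G w - L w" if "Im w = 0" for w
      proof -
        have "w = of_real (Re w)" using that by (simp add: complex_eq_iff)
        then show ?thesis using G_real[of "Re w"] by simp
      qed
      then show "\<forall>w. w \<in> {w. Im w \<le> 0} \<and> \<not> Im w \<le> 0 \<or> w \<in> {w. 0 \<le> Im w} \<and> Im w \<le> 0 \<longrightarrow>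
          H (- w) = G w - L w"
        by auto
    qed
    moreover have "{w. Im w \<le> 0} \<union> {w. 0 \<le> Im w} = UNIV" by auto
    ultimately show "continuous_on UNIV Q" by simp
  qed auto
  moreover have "bounded (range Q)"
  proof -
    have "cmod (Q w) \<le> B + (\<integral>y. cmod (lo y) \<partial>M) + (\<integral>y. cmod (hi y) \<partial>M)" for w
    proof (cases "Im w \<le> 0")
      case True
      then show ?thesis using H_lemmas(2)[of "- w"] \<open>B > 0\<close>
        by (simp add: Q_def add_increasing)
    next
      case False
      have "cmod (Q w) \<le> cmod (G w) + cmod (L w)"
        using False by (simp add: Q_def norm_triangle_ineq4)
      also have "\<dots> \<le> B + (\<integral>y. cmod (lo y) \<partial>M)"
        using False by (intro add_mono G_le L_lemmas(2)) auto
      finally show ?thesis by (simp add: add_increasing2)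
    qed
    then show ?thesis unfolding bounded_iff by blast
  qed
  ultimately have "Q constant_on UNIV" by (rule Liouville_theorem)
  then obtain c where c: "\<And>w. Q w = c" by (auto simp: constant_on_def)
  \<comment> \<open>All frequencies of \<open>H\<close> are strictly positive, so \<open>H\<close> decays along the imaginary axis.\<close>
  have "H (\<i> * of_nat n) = c" for n using c[of "- (\<i> * of_nat n)"] by (simp add: Q_def)
  then have "c = 0" using H_lemmas(5) by (simp add: LIMSEQ_const_iff)
  then have "H (- of_real t) = 0" using c[of "of_real t"] by (simp add: Q_def)
  then have "exp (- (\<i> * of_real \<sigma> * of_real t)) * H (- of_real t) = 0" by simp
  also have "exp (- (\<i> * of_real \<sigma> * of_real t)) * H (- of_real t)
      = (\<integral>y. hi y * exp (- \<i> * of_real (t * u y)) \<partial>M)"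
    unfolding H_def
    by (subst integral_mult_right_zero[symmetric], intro Bochner_Integration.integral_cong)
      (auto simp: algebra_simps simp flip: exp_add)
  finally show ?thesis unfolding hi_def .
qed

section \<open>Periodic test functions\<close>

text \<open>Functions of period \<open>2 * pi / a\<close> in each coordinate are handled as functions on complex
\<open>d\<close>-space composed with the covering map of the torus; continuity and Borel measurability then
refer to an ordinary Euclidean space.\<close>

definition torus_map :: "real \<Rightarrow> real ^ 'd \<Rightarrow> complex ^ 'd" where
  "torus_map a x = (\<chi> j. exp (\<i> * of_real (a * x $ j)))"

inductive trig_poly :: "real \<Rightarrow> (real ^ 'd \<Rightarrow> complex) \<Rightarrow> bool" for a where
  character: "trig_poly a (\<lambda>x. c * exp (\<i> * of_real (a * (lattice_point k \<bullet> x))))"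
| add: "trig_poly a S \<Longrightarrow> trig_poly a T \<Longrightarrow> trig_poly a (\<lambda>x. S x + T x)"

lemma lattice_point_simps [simp]:
  "lattice_point 0 = 0" "lattice_point (- k) = - lattice_point k"
  "lattice_point (k + l) = lattice_point k + lattice_point l"
  "lattice_point (axis j 1) = axis j 1"
  by (auto simp: lattice_point_def vec_eq_iff axis_def)

lemma trig_poly_const: "trig_poly a (\<lambda>x. c)"
  using trig_poly.character[of a c 0] by simp

lemma trig_poly_sum:
  assumes "finite I" "\<And>i. i \<in> I \<Longrightarrow> trig_poly a (T i)"
  shows "trig_poly a (\<lambda>x. \<Sum>i\<in>I. T i x)"
  using assms by (induction I) (auto intro: trig_poly_const trig_poly.add)

lemma trig_poly_mult_character:
  assumes "trig_poly a T"
  shows "trig_poly a (\<lambda>x. c * exp (\<i> * of_real (a * (lattice_point k \<bullet> x))) * T x)"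
  using assms
proof induction
  case (character d l)
  have "(\<lambda>x. c * exp (\<i> * of_real (a * (lattice_point k \<bullet> x))) * (d * exp (\<i> * of_real (a * (lattice_point l \<bullet> x)))))
      = (\<lambda>x. (c * d) * exp (\<i> * of_real (a * (lattice_point (k + l) \<bullet> x))))"
    by (simp add: fun_eq_iff inner_add_left distrib_left exp_add mult_ac)
  then show ?case by (simp only: trig_poly.character)
next
  case (add S T)
  then show ?case by (simp add: distrib_left trig_poly.add)
qed

lemma trig_poly_mult:
  assumes "trig_poly a S" "trig_poly a T"
  shows "trig_poly a (\<lambda>x. S x * T x)"
  using assms(1)
proof induction
  case (character c k)
  then show ?case using trig_poly_mult_character[OF assms(2)] .
next
  case (add S S')
  then show ?case by (simp add: distrib_right trig_poly.add)
qed

lemma trig_poly_Re_coordinate: "trig_poly a (\<lambda>x. of_real (Re (torus_map a x $ j)))"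
proof -
  have "(\<lambda>x. complex_of_real (Re (torus_map a x $ j)))
      = (\<lambda>x. 1/2 * exp (\<i> * of_real (a * (lattice_point (axis j 1) \<bullet> x)))
          + 1/2 * exp (\<i> * of_real (a * (lattice_point (- axis j 1) \<bullet> x))))"
    by (auto simp: fun_eq_iff torus_map_def complex_eq_iff Re_exp Im_exp inner_axis')
  then show ?thesis by (simp only:) (intro trig_poly.intros)
qed

lemma trig_poly_Im_coordinate: "trig_poly a (\<lambda>x. of_real (Im (torus_map a x $ j)))"
proof -
  have "(\<lambda>x. complex_of_real (Im (torus_map a x $ j)))
      = (\<lambda>x. (- \<i>/2) * exp (\<i> * of_real (a * (lattice_point (axis j 1) \<bullet> x)))
          + (\<i>/2) * exp (\<i> * of_real (a * (lattice_point (- axis j 1) \<bullet> x))))"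
    by (auto simp: fun_eq_iff torus_map_def complex_eq_iff Re_exp Im_exp inner_axis')
  then show ?thesis by (simp only:) (intro trig_poly.intros)
qed

lemma vec_complex_expand:
  fixes z :: "complex ^ 'd"
  shows "z = (\<Sum>j\<in>UNIV. Re (z $ j) *\<^sub>R axis j 1 + Im (z $ j) *\<^sub>R axis j \<i>)"
proof (subst vec_eq_iff, intro allI)
  fix i
  have "(Re (z $ j) *\<^sub>R axis j 1 + Im (z $ j) *\<^sub>R axis j \<i>) $ i = (if i = j then z $ j else 0)" for j
    by (simp add: axis_def complex_eq_iff)
  then have "(\<Sum>j\<in>UNIV. Re (z $ j) *\<^sub>R axis j 1 + Im (z $ j) *\<^sub>R axis j \<i>) $ i
      = (\<Sum>j\<in>UNIV. if i = j then z $ j else 0)"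
    by (simp only: sum_component)
  also have "\<dots> = z $ i" by simp
  finally show "z $ i = (\<Sum>j\<in>UNIV. Re (z $ j) *\<^sub>R axis j 1 + Im (z $ j) *\<^sub>R axis j \<i>) $ i" by simp
qed

text \<open>Real polynomials in the real and imaginary parts of the coordinates pull back to trigonometric
polynomials; this brings the Stone--Weierstrass theorem to bear on the torus.\<close>

lemma trig_poly_real_polynomial_function:
  fixes q :: "complex ^ 'd \<Rightarrow> real"
  assumes "real_polynomial_function q"
  shows "trig_poly a (\<lambda>x. of_real (q (torus_map a x)))"
  using assms
proof induction
  case (linear q)
  then have lin: "linear q" by (rule bounded_linear.linear)
  have expand: "q z = (\<Sum>j\<in>UNIV. Re (z $ j) * q (axis j 1) + Im (z $ j) * q (axis j \<i>))" for z
    using arg_cong[OF vec_complex_expand[of z], of q]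
    by (simp only: linear_sum[OF lin] linear_add[OF lin] linear_scale[OF lin] real_scaleR_def)
  have eq: "(\<lambda>x. complex_of_real (q (torus_map a x))) =
      (\<lambda>x. \<Sum>j\<in>UNIV. of_real (Re (torus_map a x $ j)) * of_real (q (axis j 1))
        + of_real (Im (torus_map a x $ j)) * of_real (q (axis j \<i>)))"
    by (rule ext, subst expand) (simp only: of_real_sum of_real_add of_real_mult)
  have "trig_poly a (\<lambda>x. of_real (Re (torus_map a x $ j)) * of_real (q (axis j 1))
      + of_real (Im (torus_map a x $ j)) * of_real (q (axis j \<i>)))" for j
    by (rule trig_poly.add; rule trig_poly_mult;
        rule trig_poly_Re_coordinate trig_poly_Im_coordinate trig_poly_const)
  then show ?case
    by (subst eq) (rule trig_poly_sum; simp)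
next
  case (const c)
  then show ?case by (simp add: trig_poly_const)
next
  case (add f g)
  then show ?case by (simp add: trig_poly.add)
next
  case (mult f g)
  then show ?case by (simp add: trig_poly_mult)
qed

lemma continuous_torus_map: "continuous_on UNIV (torus_map a)"
  unfolding torus_map_def by (intro continuous_intros)

lemma norm_torus_map_le: "norm (torus_map a x :: complex ^ 'd) \<le> CARD('d)"
proof -
  have "norm (torus_map a x :: complex ^ 'd) \<le> (\<Sum>j\<in>UNIV. norm (torus_map a x $ j))"
    unfolding norm_vec_def by (rule L2_set_le_sum) simp
  also have "\<dots> = CARD('d)" by (simp add: torus_map_def)
  finally show ?thesis .
qed

lemma borel_measurable_lebesgue_continuous:
  fixes f :: "'a::euclidean_space \<Rightarrow> 'b::topological_space"
  assumes "continuous_on UNIV f"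
  shows "f \<in> borel_measurable lebesgue"
  by (intro measurable_completion) (use borel_measurable_continuous_onI[OF assms] in simp)

lemma torus_map_borel_lebesgue: "torus_map a \<in> borel_measurable lebesgue"
  by (rule borel_measurable_lebesgue_continuous) (rule continuous_torus_map)

lemma integrable_mult_bounded:
  fixes g p :: "'m \<Rightarrow> complex"
  assumes g: "integrable M g" and [measurable]: "p \<in> borel_measurable M" and le: "\<And>y. cmod (p y) \<le> c"
  shows "integrable M (\<lambda>y. g y * p y)"
proof (rule Bochner_Integration.integrable_bound)
  show "integrable M (\<lambda>y. c * cmod (g y))" using g by simp
  have [measurable]: "g \<in> borel_measurable M" using g by auto
  show "(\<lambda>y. g y * p y) \<in> borel_measurable M" by measurable
  have "cmod (g y * p y) \<le> c * cmod (g y)" for y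
    using mult_left_mono[OF le[of y] norm_ge_zero[of "g y"]] by (simp add: norm_mult mult.commute)
  then show "AE y in M. norm (g y * p y) \<le> norm (c * cmod (g y))"
    by (auto intro!: AE_I2 order_trans[OF _ abs_ge_self])
qed

text \<open>In this context the transform of \<open>g\<close> vanishes on the lattice of spacing \<open>a\<close>, that is, the
complex measure with density \<open>g\<close> has a push-forward to the torus all of whose Fourier coefficients
vanish. The lemmas show that this push-forward is zero.\<close>

context
  fixes g :: "real ^ 'd \<Rightarrow> complex" and a :: real
  assumes g: "integrable lebesgue g"
    and coefficients: "\<And>k. (LINT y|lebesgue. g y * exp (- \<i> * of_real (a * (lattice_point k \<bullet> y)))) = 0"
begin

lemma integral_trig_poly:
  assumes "trig_poly a T"
  shows "integrable lebesgue (\<lambda>y. g y * T y) \<and> (LINT y|lebesgue. g y * T y) = 0"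
  using assms
proof induction
  case (character c k)
  have meas: "(\<lambda>y::real^'d. exp (\<i> * of_real (a * (lattice_point k \<bullet> y)))) \<in> borel_measurable lebesgue"
    by (intro borel_measurable_lebesgue_continuous continuous_intros)
  have "integrable lebesgue (\<lambda>y. g y * exp (\<i> * of_real (a * (lattice_point k \<bullet> y))))"
    by (rule integrable_mult_bounded[OF g meas, of 1]) simp
  moreover have "(LINT y|lebesgue. g y * exp (\<i> * of_real (a * (lattice_point k \<bullet> y)))) = 0"
    using coefficients[of "- k"] by simp
  ultimately show ?case
    by (simp add: mult.left_commute)
next
  case (add S T)
  then show ?case by (simp add: distrib_left)
qed

lemma integral_continuous_torus:
  fixes p :: "complex ^ 'd \<Rightarrow> real"
  assumes p: "continuous_on UNIV p"
  shows "(LINT y|lebesgue. g y * of_real (p (torus_map a y))) = 0"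
proof -
  \<comment> \<open>A ball that contains the image of the covering map serves as the compact set.\<close>
  define K where "K = cball (0 :: complex ^ 'd) CARD('d)"
  have K: "torus_map a y \<in> K" for y
    by (simp add: K_def norm_torus_map_le)
  define I where "I = (LINT y|lebesgue. g y * of_real (p (torus_map a y)))"
  have "cmod I \<le> e * (LINT y|lebesgue. cmod (g y))" if "e > 0" for e
  proof -
    have "compact K" by (simp add: K_def)
    then obtain q where q: "real_polynomial_function q" "\<And>z. z \<in> K \<Longrightarrow> \<bar>p z - q z\<bar> < e"
      using Stone_Weierstrass_real_polynomial_function[of K p e] p \<open>e > 0\<close> continuous_on_subset by blast
    have T: "integrable lebesgue (\<lambda>y. g y * of_real (q (torus_map a y)))"
      "(LINT y|lebesgue. g y * of_real (q (torus_map a y))) = 0"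
      using integral_trig_poly[OF trig_poly_real_polynomial_function[OF q(1)]] by auto
    have "continuous_on UNIV (\<lambda>z. complex_of_real (p z))" by (intro continuous_intros p)
    moreover have "continuous_on UNIV (\<lambda>z. complex_of_real (q z))"
      using q(1) continuous_on_polymonial_function[of q UNIV]
      by (intro continuous_on_of_real) (simp add: real_polynomial_function_eq)
    ultimately have "continuous_on UNIV (\<lambda>z. complex_of_real (p z - q z))"
      by (simp add: continuous_on_diff)
    then have meas: "(\<lambda>y. complex_of_real (p (torus_map a y) - q (torus_map a y))) \<in> borel_measurable lebesgue"
      by (intro measurable_compose[OF torus_map_borel_lebesgue] borel_measurable_continuous_onI)
    have bound: "cmod (complex_of_real (p (torus_map a y) - q (torus_map a y))) \<le> e" for y
      using q(2)[OF K[of y]] by (simp only: norm_of_real less_imp_le)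
    have D: "integrable lebesgue (\<lambda>y. g y * of_real (p (torus_map a y) - q (torus_map a y)))"
      by (rule integrable_mult_bounded[OF g meas bound])
    have "I = (LINT y|lebesgue. g y * of_real (p (torus_map a y) - q (torus_map a y)) + g y * of_real (q (torus_map a y)))"
      unfolding I_def by (simp flip: distrib_left)
    also have "\<dots> = (LINT y|lebesgue. g y * of_real (p (torus_map a y) - q (torus_map a y)))"
      by (subst Bochner_Integration.integral_add[OF D T(1)]) (simp add: T(2))
    also have "cmod \<dots> \<le> (LINT y|lebesgue. e * cmod (g y))"
    proof (rule order_trans[OF integral_norm_bound], rule integral_mono)
      show "cmod (g y * of_real (p (torus_map a y) - q (torus_map a y))) \<le> e * cmod (g y)" for y
        unfolding norm_mult using mult_left_mono[OF bound norm_ge_zero[of "g y"]] by (simp add: mult.commute)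
    qed (use D g in auto)
    finally show ?thesis by simp
  qed
  then have "\<forall>\<^sub>F e in at_right 0. cmod I \<le> e * (LINT y|lebesgue. cmod (g y))"
    by (auto intro: eventually_mono[OF eventually_at_right_less])
  moreover have "((\<lambda>e. e * (LINT y|lebesgue. cmod (g y))) \<longlongrightarrow> 0 * (LINT y|lebesgue. cmod (g y))) (at_right 0)"
    by (intro tendsto_intros)
  ultimately have "cmod I \<le> 0 * (LINT y|lebesgue. cmod (g y))"
    by (intro tendsto_lowerbound[where F = "at_right 0" and a = "cmod I"]) auto
  then show ?thesis by (simp add: I_def)
qed

lemma integral_dominated_vanishes:
  fixes p :: "complex ^ 'd \<Rightarrow> complex"
  assumes "\<And>n. F n \<in> borel_measurable borel" "p \<in> borel_measurable borel"
    and "\<And>n z. cmod (F n z) \<le> c" "\<And>z. (\<lambda>n. F n z) \<longlonglongrightarrow> p z"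
    and "\<And>n::nat. (LINT y|lebesgue. g y * F n (torus_map a y)) = 0"
  shows "(LINT y|lebesgue. g y * p (torus_map a y)) = 0"
proof -
  have "(\<lambda>n. LINT y|lebesgue. g y * F n (torus_map a y)) \<longlonglongrightarrow> (LINT y|lebesgue. g y * p (torus_map a y))"
  proof (rule integral_dominated_convergence[where w = "\<lambda>y. c * cmod (g y)"])
    show "(\<lambda>y. g y * p (torus_map a y)) \<in> borel_measurable lebesgue"
      using g measurable_compose[OF torus_map_borel_lebesgue assms(2)] by (intro borel_measurable_times) auto
    show "(\<lambda>y. g y * F n (torus_map a y)) \<in> borel_measurable lebesgue" for n
      using g measurable_compose[OF torus_map_borel_lebesgue assms(1)] by (intro borel_measurable_times) auto
    show "AE y in lebesgue. norm (g y * F n (torus_map a y)) \<le> c * cmod (g y)" for n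
      unfolding norm_mult using mult_left_mono[OF assms(3) norm_ge_zero]
      by (intro AE_I2) (simp add: mult.commute)
    show "AE y in lebesgue. (\<lambda>n. g y * F n (torus_map a y)) \<longlonglongrightarrow> g y * p (torus_map a y)"
      by (intro AE_I2 tendsto_intros assms(4))
  qed (use g in auto)
  then show ?thesis using assms(5) by (simp add: LIMSEQ_const_iff)
qed

text \<open>The indicator of an open set is the increasing limit of truncated multiples of the distance to
the complement.\<close>

lemma integral_open_torus:
  fixes U :: "(complex ^ 'd) set"
  assumes "open U"
  shows "(LINT y|lebesgue. g y * indicator U (torus_map a y)) = 0"
proof (cases "U = UNIV")
  case True
  then show ?thesis using integral_continuous_torus[of "\<lambda>_. 1"] by simp
next
  case False
  define F :: "nat \<Rightarrow> complex ^ 'd \<Rightarrow> real" where "F n z = min 1 (of_nat n * infdist z (- U))" for n z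
  have F_cont: "continuous_on UNIV (F n)" for n
    unfolding F_def by (intro continuous_intros)
  show ?thesis
  proof (rule integral_dominated_vanishes[where F = "\<lambda>n z. of_real (F n z)" and c = 1])
    show "(\<lambda>z. complex_of_real (F n z)) \<in> borel_measurable borel" for n
      using F_cont by (intro borel_measurable_continuous_onI continuous_intros)
    show "indicator U \<in> borel_measurable borel" using \<open>open U\<close> by (intro borel_measurable_indicator borel_open)
    show "cmod (of_real (F n z)) \<le> 1" for n z
      using infdist_nonneg[of z "- U"] by (simp add: F_def)
    show "(LINT y|lebesgue. g y * of_real (F n (torus_map a y))) = 0" for n
      by (rule integral_continuous_torus[OF F_cont])
    show "(\<lambda>n. complex_of_real (F n z)) \<longlonglongrightarrow> indicator U z" for z
    proof (cases "z \<in> U")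
      case True
      have "- U \<noteq> {}" using False by auto
      then have "infdist z (- U) \<noteq> 0"
        using in_closed_iff_infdist_zero[of "- U" z] \<open>open U\<close> True by (simp add: closed_Compl)
      then have pos: "infdist z (- U) > 0" using infdist_nonneg[of z "- U"] by linarith
      obtain N where N: "1 < of_nat N * infdist z (- U)"
        using reals_Archimedean3[OF pos] by blast
      have "F n z = 1" if "n \<ge> N" for n
      proof -
        have "of_nat N * infdist z (- U) \<le> of_nat n * infdist z (- U)"
          using that pos by (intro mult_right_mono) auto
        then show ?thesis using N by (simp add: F_def)
      qed
      then have "\<forall>\<^sub>F n in sequentially. of_real (F n z) = (1::complex)"
        by (auto simp: eventually_sequentially intro!: exI[of _ N])
      then show ?thesis using True by (simp add: tendsto_eventually)
    next
      case z: False
      then show ?thesis by (simp add: F_def)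
    qed
  qed
qed

lemma integral_indicator_torus:
  fixes A :: "(complex ^ 'd) set"
  assumes "A \<in> sets borel"
  shows "(LINT y|lebesgue. g y * indicator A (torus_map a y)) = 0"
proof -
  have int: "integrable lebesgue (\<lambda>y. g y * indicator B (torus_map a y))"
    if "B \<in> sets borel" for B :: "(complex ^ 'd) set"
    by (rule integrable_mult_bounded[OF g
          measurable_compose[OF torus_map_borel_lebesgue borel_measurable_indicator[OF that]], where c = 1])
      (simp add: indicator_def)
  have total: "(LINT y|lebesgue. g y) = 0" using integral_open_torus[of UNIV] by simp
  have "Int_stable {S :: (complex ^ 'd) set. open S}" by (auto simp: Int_stable_def)
  moreover have "{S :: (complex ^ 'd) set. open S} \<subseteq> Pow UNIV" by auto
  moreover have "A \<in> sigma_sets UNIV {S. open S}" using assms by (simp add: sets_borel)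
  ultimately show ?thesis
  proof (induction rule: sigma_sets_induct_disjoint)
    case (basic U)
    then show ?case by (simp add: integral_open_torus)
  next
    case empty
    then show ?case by simp
  next
    case (compl B)
    then have "B \<in> sets borel" by (simp add: sets_borel)
    then have "(LINT y|lebesgue. g y - g y * indicator B (torus_map a y)) = 0"
      using g int compl total by simp
    moreover have "g y - g y * indicator B (torus_map a y) = g y * indicator (UNIV - B) (torus_map a y)" for y
      by (auto simp: indicator_def)
    ultimately show ?case by simp
  next
    case (union B)
    then have B: "B i \<in> sets borel" for i by (auto simp: sets_borel)
    show ?case
    proof (rule integral_dominated_vanishes[where F = "\<lambda>n. indicator (\<Union>i<n. B i)" and c = 1])
      show "indicator (\<Union>i<n. B i) \<in> borel_measurable borel" for n using B by (intro borel_measurable_indicator sets.finite_UN) auto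
      show "indicator (\<Union>i. B i) \<in> borel_measurable borel" using B by (intro borel_measurable_indicator sets.countable_UN) auto
      show "cmod (indicator (\<Union>i<n. B i) z) \<le> 1" for n z by (simp add: indicator_def)
      show "(\<lambda>n. indicator (\<Union>i<n. B i) z :: complex) \<longlonglongrightarrow> indicator (\<Union>i. B i) z" for z
        by (rule LIMSEQ_indicator_UN)
      have "indicator (\<Union>i<n. B i) z = (\<Sum>i<n. indicator (B i) z :: complex)" for n z
        using union.hyps(1) by (intro indicator_UN_disjoint) (auto simp: disjoint_family_on_def)
      then show "(LINT y|lebesgue. g y * indicator (\<Union>i<n. B i) (torus_map a y)) = 0" for n
        using Bochner_Integration.integral_sum[of "{..<n}" lebesgue "\<lambda>i y. g y * indicator (B i) (torus_map a y)"]
          int[OF B] union.IH by (simp add: sum_distrib_left)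
    qed
  qed
qed

lemma integral_bounded_torus:
  fixes p :: "complex ^ 'd \<Rightarrow> complex"
  assumes p: "p \<in> borel_measurable borel" and le: "\<And>z. cmod (p z) \<le> c"
  shows "(LINT y|lebesgue. g y * p (torus_map a y)) = 0"
proof -
  obtain F where F: "\<And>i. simple_function borel (F i)" "\<And>z. (\<lambda>i. F i z) \<longlonglongrightarrow> p z"
    "\<And>i z. cmod (F i z) \<le> 2 * cmod (p z)"
    using borel_measurable_implies_sequence_metric[OF p, of 0] by auto
  have F_meas: "F n \<in> borel_measurable borel" for n
    using F(1) by (rule borel_measurable_simple_function)
  show ?thesis
  proof (rule integral_dominated_vanishes[where F = F and c = "2 * c"])
    show "cmod (F n z) \<le> 2 * c" for n z using F(3)[of n z] le[of z] by linarith
    show "(LINT y|lebesgue. g y * F n (torus_map a y)) = 0" for n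
    proof -
      define V where "V = range (F n)"
      have "finite V" using F(1)[of n] by (simp add: V_def simple_function_def)
      have sets: "F n -` {v} \<in> sets borel" for v
        using measurable_sets[OF F_meas, of "{v}"] by simp
      have eq: "F n z = (\<Sum>v\<in>V. v * indicator (F n -` {v}) z)" for z
        using \<open>finite V\<close> by (auto simp: indicator_def V_def if_distrib sum.delta cong: if_cong)
      have int: "integrable lebesgue (\<lambda>y. g y * indicator (F n -` {v}) (torus_map a y))" for v
        by (rule integrable_mult_bounded[OF g
              measurable_compose[OF torus_map_borel_lebesgue borel_measurable_indicator[OF sets]], where c = 1])
          (simp add: indicator_def)
      have "(LINT y|lebesgue. g y * F n (torus_map a y))
          = (LINT y|lebesgue. (\<Sum>v\<in>V. v * (g y * indicator (F n -` {v}) (torus_map a y))))"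
        by (subst eq) (simp add: sum_distrib_left mult_ac)
      also have "\<dots> = (\<Sum>v\<in>V. v * (LINT y|lebesgue. g y * indicator (F n -` {v}) (torus_map a y)))"
        using int by simp
      also have "\<dots> = 0" using integral_indicator_torus[OF sets] by simp
      finally show ?thesis .
    qed
  qed (use F_meas F(2) p in auto)
qed

end

section \<open>Mass in a period cell and injectivity of the Fourier transform\<close>

text \<open>The inverse of the covering map on the period cell, extended Borel measurably to the whole
space. It turns a function on the cell into a periodic one.\<close>

definition torus_section :: "real \<Rightarrow> complex ^ 'd \<Rightarrow> real ^ 'd" where
  "torus_section a z = (\<chi> j. Im (Ln (z $ j)) / a)"

lemma torus_section_borel: "torus_section a \<in> borel_measurable borel"
proof (subst borel_measurable_euclidean_space, intro ballI)
  fix b :: "real ^ 'd" assume "b \<in> Basis"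
  then obtain j where b: "b = axis j 1" by (auto simp: Basis_vec_def)
  have "(\<lambda>z :: complex ^ 'd. z $ j) \<in> borel_measurable borel"
    by (intro borel_measurable_continuous_onI continuous_intros)
  then have "(\<lambda>z :: complex ^ 'd. Ln (z $ j)) \<in> borel_measurable borel"
    by (rule measurable_compose[OF _ Ln_measurable])
  then have "(\<lambda>z :: complex ^ 'd. Im (Ln (z $ j)) / a) \<in> borel_measurable borel"
    by measurable
  then show "(\<lambda>z :: complex ^ 'd. torus_section a z \<bullet> b) \<in> borel_measurable borel"
    by (simp add: torus_section_def b inner_axis)
qed

lemma torus_section_torus_map:
  assumes "a > 0" and "y \<in> box (\<chi> j. - (pi / a)) (\<chi> j. pi / a)"
  shows "torus_section a (torus_map a y) = y"
proof -
  have "- pi < a * y $ j \<and> a * y $ j \<le> pi" for j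
  proof -
    have "- (pi / a) < y $ j" "y $ j < pi / a" using assms(2) by (auto simp: mem_box_cart)
    then show ?thesis using assms(1) by (simp add: field_simps)
  qed
  then have "Ln (exp (\<i> * of_real (a * y $ j))) = \<i> * of_real (a * y $ j)" for j
    by (intro Ln_exp) auto
  then show ?thesis
    using assms(1) by (simp add: torus_section_def torus_map_def vec_eq_iff)
qed

lemma complex_borel_version:
  fixes g :: "real ^ 'd \<Rightarrow> complex"
  assumes "g \<in> borel_measurable lebesgue"
  obtains g' where "g' \<in> borel_measurable borel" "AE y in lebesgue. g y = g' y"
proof -
  have "(\<lambda>y. Re (g y)) \<in> borel_measurable lebesgue" "(\<lambda>y. Im (g y)) \<in> borel_measurable lebesgue"
    using assms by auto
  from this[THEN completion_ex_borel_measurable_real] obtain u v where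
    uv: "u \<in> borel_measurable lborel" "v \<in> borel_measurable lborel"
    "AE y in lborel. Re (g y) = u y" "AE y in lborel. Im (g y) = v y" by blast
  show thesis
  proof
    show "(\<lambda>y. Complex (u y) (v y)) \<in> borel_measurable borel"
      using uv(1,2) by (simp add: borel_measurable_complex_iff)
    have "AE y in lborel. g y = Complex (u y) (v y)"
      using uv(3,4) by eventually_elim (simp add: complex_eq_iff)
    then show "AE y in lebesgue. g y = Complex (u y) (v y)" by (rule AE_completion)
  qed
qed

lemma mult_cnj_sgn: "z * cnj (sgn z) = of_real (cmod z)"
  by (cases "z = 0") (auto simp: sgn_div_norm scaleR_conv_of_real complex_norm_square[symmetric] power2_eq_square field_simps)

text \<open>Testing against the periodic continuation \<open>p\<close> of the conjugate sign of \<open>g\<close> from the cell gives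
\<open>0\<close>. Inside the cell the product is the modulus of \<open>g\<close>; outside it is at most the modulus
in absolute value. Equivalently, the periodization of \<open>g\<close> vanishes, so the values in the cell are
cancelled by translates from outside.\<close>

lemma mass_in_period_cell_le:
  fixes g :: "real ^ 'd \<Rightarrow> complex"
  assumes g: "integrable lebesgue g" and "a > 0"
    and coefficients: "\<And>k. (LINT y|lebesgue. g y * exp (- \<i> * of_real (a * (lattice_point k \<bullet> y)))) = 0"
    and C: "C = cbox (\<chi> j. - (pi / a)) (\<chi> j. pi / a)"
  shows "(LINT y:C|lebesgue. cmod (g y)) \<le> (LINT y:-C|lebesgue. cmod (g y))"
proof -
  obtain g' where g': "g' \<in> borel_measurable borel" "AE y in lebesgue. g y = g' y"
    using complex_borel_version borel_measurable_integrable[OF g] by blast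
  define p where "p z = cnj (sgn (g' (torus_section a z)))" for z
  have p_meas: "p \<in> borel_measurable borel"
    unfolding p_def
    using measurable_compose[OF measurable_compose[OF torus_section_borel g'(1)] borel_measurable_sgn]
    by (rule measurable_compose) (intro borel_measurable_continuous_onI continuous_intros)
  have p_le: "cmod (p z) \<le> 1" for z by (simp add: p_def norm_sgn)
  have zero: "(LINT y|lebesgue. g y * p (torus_map a y)) = 0"
    by (rule integral_bounded_torus[OF g coefficients p_meas p_le])
  have int: "integrable lebesgue (\<lambda>y. g y * p (torus_map a y))"
    by (rule integrable_mult_bounded[OF g measurable_compose[OF torus_map_borel_lebesgue p_meas] p_le])
  have C_sets: "C \<in> sets lebesgue" "- C \<in> sets lebesgue" by (auto simp: C)
  have int_C: "integrable lebesgue (\<lambda>y. indicator C y *\<^sub>R (g y * p (torus_map a y)))"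
    "integrable lebesgue (\<lambda>y. indicator (- C) y *\<^sub>R (g y * p (torus_map a y)))"
    using C_sets int by (auto intro: integrable_mult_indicator)
  have int_abs: "integrable lebesgue (\<lambda>y. indicator (- C) y *\<^sub>R cmod (g y))"
    using C_sets g by (intro integrable_mult_indicator) auto
  define J where "J = (LINT y|lebesgue. indicator (- C) y *\<^sub>R (g y * p (torus_map a y)))"
  \<comment> \<open>On faces of the cell the logarithm may pick the opposite face, so they are discarded.\<close>
  have boundary: "AE y in lebesgue. y \<notin> C - box (\<chi> j. - (pi / a)) (\<chi> j. pi / a)"
    using negligible_frontier_interval[of "\<chi> j. - (pi / a)" "\<chi> j. pi / a :: real ^ 'd"]
    by (intro AE_not_in) (simp add: C negligible_iff_null_sets)
  have inside: "(LINT y|lebesgue. indicator C y *\<^sub>R (g y * p (torus_map a y)))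
      = (LINT y|lebesgue. complex_of_real (indicator C y *\<^sub>R cmod (g y)))"
  proof (rule integral_cong_AE)
    show "AE y in lebesgue. indicator C y *\<^sub>R (g y * p (torus_map a y))
        = complex_of_real (indicator C y *\<^sub>R cmod (g y))"
      using boundary g'(2)
    proof eventually_elim
      case (elim y)
      show ?case
      proof (cases "y \<in> C")
        case True
        with elim have "torus_section a (torus_map a y) = y"
          using torus_section_torus_map[OF \<open>a > 0\<close>] by auto
        then have "g y * p (torus_map a y) = g y * cnj (sgn (g y))" using elim(2) by (simp add: p_def)
        then show ?thesis by (simp only: mult_cnj_sgn) (simp add: scaleR_conv_of_real)
      qed auto
    qed
  qed (use int_C C_sets g in \<open>auto intro!: borel_measurable_of_real borel_measurable_scaleR borel_measurable_indicator\<close>)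
  have "0 = (LINT y|lebesgue. indicator C y *\<^sub>R (g y * p (torus_map a y))
      + indicator (- C) y *\<^sub>R (g y * p (torus_map a y)))"
    unfolding zero[symmetric] by (intro Bochner_Integration.integral_cong) (auto simp: indicator_def)
  also have "\<dots> = (LINT y|lebesgue. complex_of_real (indicator C y *\<^sub>R cmod (g y))) + J"
    unfolding J_def inside[symmetric] by (rule Bochner_Integration.integral_add[OF int_C])
  also have "\<dots> = of_real (LINT y:C|lebesgue. cmod (g y)) + J"
    unfolding set_lebesgue_integral_def by (simp only: integral_complex_of_real)
  finally have "complex_of_real (LINT y:C|lebesgue. cmod (g y)) = - J"
    by (simp add: eq_neg_iff_add_eq_0)
  then have "\<bar>LINT y:C|lebesgue. cmod (g y)\<bar> = cmod J" by (metis norm_minus_cancel norm_of_real)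
  also have "cmod J \<le> (LINT y|lebesgue. indicator (- C) y *\<^sub>R cmod (g y))"
    unfolding J_def
  proof (rule norm_integral_le_integral[OF int_C(2) int_abs])
    fix y
    show "cmod (indicator (- C) y *\<^sub>R (g y * p (torus_map a y))) \<le> indicator (- C) y *\<^sub>R cmod (g y)"
      using mult_left_mono[OF p_le[of "torus_map a y"] norm_ge_zero[of "g y"]]
      by (simp add: norm_mult indicator_def)
  qed
  finally show ?thesis unfolding set_lebesgue_integral_def by simp
qed

text \<open>Here the transform vanishes on lattices of arbitrarily small spacing. Their period cells exhaust the
space, and the mass outside them tends to \<open>0\<close>.\<close>

lemma fourier_transform_zero_imp_AE_zero:
  fixes g :: "real ^ 'd \<Rightarrow> complex"
  assumes g: "integrable lebesgue g"
    and zero: "\<And>x. (LINT y|lebesgue. g y * exp (- \<i> * of_real (x \<bullet> y))) = 0"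
  shows "AE y in lebesgue. g y = 0"
proof -
  define a where "a n = inverse (real (Suc n))" for n
  define C where "C n = (cbox (\<chi> j. - (pi / a n)) (\<chi> j. pi / a n) :: (real ^ 'd) set)" for n
  have C_sets: "C n \<in> sets lebesgue" "- C n \<in> sets lebesgue" for n by (auto simp: C_def)
  have abs: "integrable lebesgue (\<lambda>y. cmod (g y))" using g by simp
  have le: "(LINT y:C n|lebesgue. cmod (g y)) \<le> (LINT y:-C n|lebesgue. cmod (g y))" for n
  proof (rule mass_in_period_cell_le[OF g _ _ C_def])
    show "(LINT y|lebesgue. g y * exp (- \<i> * of_real (a n * (lattice_point k \<bullet> y)))) = 0" for k
      using zero[of "a n *\<^sub>R lattice_point k"] by simp
  qed (simp add: a_def)
  have ev: "\<forall>\<^sub>F n in sequentially. y \<in> C n" for y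
  proof -
    obtain N :: nat where N: "norm y < real N * pi" using reals_Archimedean3[OF pi_gt_zero] by blast
    have "y \<in> C n" if "n \<ge> N" for n
    proof -
      have "\<bar>y $ j\<bar> \<le> pi / a n" for j
      proof -
        have "\<bar>y $ j\<bar> \<le> norm y" by (rule component_le_norm_cart)
        also have "\<dots> \<le> real N * pi" using N by simp
        also have "\<dots> \<le> real (Suc n) * pi" using that by (intro mult_right_mono) auto
        finally show ?thesis by (simp add: a_def field_simps)
      qed
      then show ?thesis unfolding C_def mem_box_cart by (simp add: abs_le_iff minus_le_iff)
    qed
    then show ?thesis by (auto simp: eventually_sequentially)
  qed
  have "(\<lambda>n. LINT y:C n|lebesgue. cmod (g y)) \<longlonglongrightarrow> (LINT y|lebesgue. cmod (g y))"
    unfolding set_lebesgue_integral_def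
  proof (rule integral_dominated_convergence[where w = "\<lambda>y. cmod (g y)"])
    show "AE y in lebesgue. (\<lambda>n. indicator (C n) y *\<^sub>R cmod (g y)) \<longlonglongrightarrow> cmod (g y)"
    proof (rule AE_I2, rule tendsto_eventually)
      fix y
      show "\<forall>\<^sub>F n in sequentially. indicator (C n) y *\<^sub>R cmod (g y) = cmod (g y)"
        using ev[of y] by eventually_elim simp
    qed
    show "(\<lambda>y. indicator (C n) y *\<^sub>R cmod (g y)) \<in> borel_measurable lebesgue" for n
      using abs C_sets by (intro borel_measurable_scaleR borel_measurable_indicator) auto
  qed (use abs in \<open>auto simp: indicator_def\<close>)
  moreover have "(\<lambda>n. LINT y:-C n|lebesgue. cmod (g y)) \<longlonglongrightarrow> (LINT y|(lebesgue :: (real ^ 'd) measure). 0 :: real)"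
    unfolding set_lebesgue_integral_def
  proof (rule integral_dominated_convergence[where w = "\<lambda>y. cmod (g y)"])
    show "AE y in lebesgue. (\<lambda>n. indicator (- C n) y *\<^sub>R cmod (g y)) \<longlonglongrightarrow> 0"
    proof (rule AE_I2, rule tendsto_eventually)
      fix y
      show "\<forall>\<^sub>F n in sequentially. indicator (- C n) y *\<^sub>R cmod (g y) = 0"
        using ev[of y] by eventually_elim simp
    qed
    show "(\<lambda>y. indicator (- C n) y *\<^sub>R cmod (g y)) \<in> borel_measurable lebesgue" for n
      using abs C_sets by (intro borel_measurable_scaleR borel_measurable_indicator) auto
  qed (use abs in \<open>auto simp: indicator_def\<close>)
  ultimately have "(LINT y|lebesgue. cmod (g y)) \<le> (LINT y|(lebesgue :: (real ^ 'd) measure). 0 :: real)"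
    by (rule LIMSEQ_le) (use le in auto)
  then have "(LINT y|lebesgue. cmod (g y)) = 0"
    by (intro antisym) auto
  then have "AE y in lebesgue. cmod (g y) = 0"
    using integral_nonneg_eq_0_iff_AE[OF abs] by simp
  then show ?thesis by simp
qed

section \<open>Entire functions and spectra in the cube\<close>

lemma entire_multi_along_line:
  assumes "entire_multi F"
  shows "(\<lambda>w. F (z + w *s b)) holomorphic_on UNIV"
proof (subst holomorphic_on_open[OF open_UNIV], intro ballI)
  fix w :: complex
  obtain D where D: "(F has_derivative D) (at (z + w *s b))" "\<And>c v. D (c *s v) = c * D v"
    using assms unfolding entire_multi_def by blast
  have "linear (\<lambda>v. v *s b)"
    by (rule linearI) (simp_all add: vec_eq_iff algebra_simps)
  then have "((\<lambda>v. v *s b) has_derivative (\<lambda>v. v *s b)) (at w)"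
    by (intro bounded_linear_imp_has_derivative) (simp add: linear_conv_bounded_linear)
  from has_derivative_add[OF has_derivative_const this]
  have "((\<lambda>v. z + v *s b) has_derivative (\<lambda>v. v *s b)) (at w)" by simp
  from has_derivative_compose[OF this D(1)]
  have "((\<lambda>w. F (z + w *s b)) has_derivative (\<lambda>v. v * D b)) (at w)"
    by (simp only: D(2))
  moreover have "(\<lambda>v. v * D b) = (*) (D b)" by (auto simp: mult.commute)
  ultimately show "\<exists>D. ((\<lambda>w. F (z + w *s b)) has_field_derivative D) (at w)"
    by (intro exI[of _ "D b"]) (simp add: has_field_derivative_def)
qed

lemma exponential_type_le_unimodular:
  assumes "exponential_type_le \<sigma> h" and "cmod s = 1"
  shows "exponential_type_le \<sigma> (\<lambda>w. h (s * w))"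
  unfolding exponential_type_le_def
proof (intro allI impI)
  fix \<epsilon> :: real assume "\<epsilon> > 0"
  then obtain C where "\<forall>w. cmod (h w) \<le> C * exp ((\<sigma> + \<epsilon>) * cmod w)"
    using assms(1) unfolding exponential_type_le_def by blast
  then have "\<forall>w. cmod (h (s * w)) \<le> C * exp ((\<sigma> + \<epsilon>) * cmod (s * w))" by blast
  then show "\<exists>C. \<forall>w. cmod (h (s * w)) \<le> C * exp ((\<sigma> + \<epsilon>) * cmod w)"
    using assms(2) by (auto simp: norm_mult)
qed

lemma integrable_mult_phase:
  fixes g :: "real ^ 'd \<Rightarrow> complex" and p :: "real ^ 'd \<Rightarrow> real"
  assumes g: "integrable lebesgue g" and p: "continuous_on UNIV p"
  shows "integrable lebesgue (\<lambda>y. g y * exp (- \<i> * complex_of_real (p y)))"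
proof (rule integrable_mult_bounded[OF g])
  show "(\<lambda>y. exp (- \<i> * complex_of_real (p y))) \<in> borel_measurable lebesgue"
    by (intro borel_measurable_lebesgue_continuous continuous_intros p)
  show "cmod (exp (- \<i> * complex_of_real (p y))) \<le> 1" for y by simp
qed

lemma exp_character_add:
  "exp (- \<i> * complex_of_real (p + q)) = exp (- \<i> * complex_of_real p) * exp (- \<i> * complex_of_real q)"
  by (simp only: of_real_add distrib_left exp_add)

text \<open>With all coordinates of \<open>x\<close> but the \<open>j\<close>-th frozen, \<open>f\<close> is the transform of \<open>g\<close> times a phase,
and the one-variable result applies. It says that the part of \<open>g\<close> in the half-space has vanishing
transform at every \<open>x\<close>, so injectivity applies. The sign \<open>s\<close> selects one of the two sides.\<close>

lemma spectrum_in_half_space: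
  fixes f g :: "real ^ 'd \<Rightarrow> _"
  assumes rep: "wiener_represents g f" and entire: "restricts_entire_of_type \<sigma> f"
    and s: "s = 1 \<or> s = - 1"
  shows "AE y in lebesgue. \<sigma> < s * y $ j \<longrightarrow> g y = 0"
proof -
  have g: "integrable lebesgue g"
    and f: "\<And>x. f x = (LINT y|lebesgue. g y * exp (- \<i> * complex_of_real (x \<bullet> y)))"
    using rep by (auto simp: wiener_represents_def)
  obtain F where F: "entire_multi F" "exponential_type_each_le \<sigma> F"
    "\<And>x. f x = F (\<chi> j. complex_of_real (x $ j))"
    using entire by (auto simp: restricts_entire_of_type_def)
  have s_norm: "cmod (of_real s) = 1" using s by auto
  have u: "(\<lambda>y :: real ^ 'd. s * y $ j) \<in> borel_measurable lebesgue"
    by (intro borel_measurable_lebesgue_continuous continuous_intros)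
  define g' where "g' y = (if \<sigma> < s * y $ j then g y else 0)" for y
  have "{y :: real ^ 'd. \<sigma> < s * y $ j} \<in> sets lebesgue"
    using measurable_sets[OF u, of "{\<sigma><..}"] by (simp add: vimage_def)
  moreover have "g' = (\<lambda>y. indicator {y. \<sigma> < s * y $ j} y *\<^sub>R g y)"
    by (auto simp: g'_def indicator_def fun_eq_iff)
  ultimately have g'_int: "integrable lebesgue g'"
    using integrable_mult_indicator[OF _ g] by simp
  have "AE y in lebesgue. g' y = 0"
  proof (rule fourier_transform_zero_imp_AE_zero[OF g'_int])
    fix x :: "real ^ 'd"
    define k where "k y = g y * exp (- \<i> * of_real (x \<bullet> y - x $ j * y $ j))" for y
    define z where "z = (\<chi> i. if i = j then 0 else complex_of_real (x $ i))"
    have dot: "(\<chi> i. if i = j then s * t else x $ i) \<bullet> y = x \<bullet> y - x $ j * y $ j + t * (s * y $ j)" for t and y :: "real ^ 'd"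
    proof -
      have "(\<chi> i. if i = j then s * t else x $ i) = x + (s * t - x $ j) *\<^sub>R axis j 1"
        by (simp add: vec_eq_iff axis_def)
      then show ?thesis by (simp only:) (simp add: inner_add_left inner_axis' algebra_simps)
    qed
    have line: "z + w *s axis j (of_real s) = (\<chi> i. if i = j then of_real s * w else (\<chi> i. complex_of_real (x $ i)) $ i)" for w
      by (simp add: z_def vec_eq_iff axis_def)
    have "(LINT y|lebesgue. (if \<sigma> < s * y $ j then k y else 0) * exp (- \<i> * of_real (s * x $ j * (s * y $ j)))) = 0"
    proof (rule spectrum_above_type_vanishes[where h = "\<lambda>w. F (z + w *s axis j (of_real s))"])
      show "integrable lebesgue k"
        unfolding k_def by (intro integrable_mult_phase g continuous_intros)
      show "(\<lambda>w. F (z + w *s axis j (of_real s))) holomorphic_on UNIV"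
        by (rule entire_multi_along_line[OF F(1)])
      have "exponential_type_le \<sigma> (\<lambda>w. F (\<chi> i. if i = j then w else (\<chi> i. complex_of_real (x $ i)) $ i))"
        using F(2) unfolding exponential_type_each_le_def by blast
      from exponential_type_le_unimodular[OF this s_norm]
      show "exponential_type_le \<sigma> (\<lambda>w. F (z + w *s axis j (of_real s)))" by (simp only: line)
      show "F (z + complex_of_real t *s axis j (of_real s))
          = (LINT y|lebesgue. k y * exp (- \<i> * of_real (t * (s * y $ j))))" for t
      proof -
        have "z + complex_of_real t *s axis j (of_real s)
            = (\<chi> i. complex_of_real ((\<chi> i. if i = j then s * t else x $ i) $ i))"
          unfolding line by (simp add: vec_eq_iff)
        then have "F (z + complex_of_real t *s axis j (of_real s)) = f (\<chi> i. if i = j then s * t else x $ i)"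
          by (simp only: F(3))
        also have "\<dots> = (LINT y|lebesgue. k y * exp (- \<i> * of_real (t * (s * y $ j))))"
          unfolding f dot k_def exp_character_add by (simp only: mult.assoc)
        finally show ?thesis .
      qed
    qed (rule u)
    also have "(\<lambda>y. (if \<sigma> < s * y $ j then k y else 0) * exp (- \<i> * of_real (s * x $ j * (s * y $ j))))
        = (\<lambda>y. g' y * exp (- \<i> * of_real (x \<bullet> y)))"
    proof
      fix y :: "real ^ 'd"
      have "s * x $ j * (s * y $ j) = x $ j * y $ j" using s by auto
      then have "k y * exp (- \<i> * of_real (s * x $ j * (s * y $ j))) = g y * exp (- \<i> * of_real (x \<bullet> y))"
        using exp_character_add[of "x \<bullet> y - x $ j * y $ j" "x $ j * y $ j"]
        by (simp only: k_def mult.assoc diff_add_cancel)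
      then show "(if \<sigma> < s * y $ j then k y else 0) * exp (- \<i> * of_real (s * x $ j * (s * y $ j)))
          = g' y * exp (- \<i> * of_real (x \<bullet> y))"
        by (simp only: g'_def if_distrib[of "\<lambda>c. c * _"] mult_zero_left)
    qed
    finally show "(LINT y|lebesgue. g' y * exp (- \<i> * of_real (x \<bullet> y))) = 0" .
  qed
  then show ?thesis
    by eventually_elim (auto simp: g'_def split: if_splits)
qed

lemma paley_wiener_support:
  fixes f g :: "real ^ 'd \<Rightarrow> _"
  assumes "wiener_represents g f" and "restricts_entire_of_type pi f"
  shows "AE y in lebesgue. y \<notin> torus_box \<longrightarrow> g y = 0"
proof -
  have "AE y in lebesgue. \<forall>j\<in>UNIV. (pi < 1 * y $ j \<longrightarrow> g y = 0) \<and> (pi < - 1 * y $ j \<longrightarrow> g y = 0)"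
    by (intro AE_finite_allI AE_conjI spectrum_in_half_space[OF assms]) auto
  then show ?thesis
  proof eventually_elim
    case (elim y)
    show ?case
    proof
      assume "y \<notin> torus_box"
      then obtain j where "y $ j < - pi \<or> pi < y $ j"
        by (auto simp: torus_box_def mem_box_cart not_le)
      moreover have "(pi < 1 * y $ j \<longrightarrow> g y = 0) \<and> (pi < - 1 * y $ j \<longrightarrow> g y = 0)"
        using elim by blast
      ultimately show "g y = 0" by (smt (verit))
    qed
  qed
qed

text \<open>Replace \<open>x\<close> by a complex vector in the Fourier integral. On the cube the coordinates of
\<open>y\<close> are bounded by \<open>pi\<close>, which bounds the exponent by \<open>pi\<close> times the sum of
the moduli of the complex coordinates.\<close>

lemma restricts_entire_of_box_support:
  fixes g :: "real ^ 'd \<Rightarrow> complex"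
  assumes rep: "wiener_represents g f" and support: "\<And>y. g y \<noteq> 0 \<Longrightarrow> y \<in> torus_box"
  shows "restricts_entire_of_type pi f"
proof -
  have g: "integrable lebesgue g"
    and f: "\<And>x. f x = (LINT y|lebesgue. g y * exp (- \<i> * complex_of_real (x \<bullet> y)))"
    using rep by (auto simp: wiener_represents_def)
  define l where "l z y = - \<i> * (\<Sum>j\<in>UNIV. z $ j * of_real (y $ j))" for z :: "complex ^ 'd" and y :: "real ^ 'd"
  define F where "F z = (LINT y|lebesgue. g y * exp (l z y))" for z
  define n where "n y = (\<Sum>j\<in>UNIV. \<bar>y $ j\<bar>)" for y :: "real ^ 'd"
  define K where "K = CARD('d) * pi"
  have coord: "\<bar>y $ j\<bar> \<le> pi" if "g y \<noteq> 0" for y :: "real ^ 'd" and j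
    using support[OF that] by (auto simp: torus_box_def mem_box_cart abs_le_iff minus_le_iff)
  have n_nonneg: "0 \<le> n y" for y by (simp add: n_def sum_nonneg)
  have n_le: "n y \<le> K" if "g y \<noteq> 0" for y
    using sum_bounded_above[of UNIV "\<lambda>j. \<bar>y $ j\<bar>" pi] coord[OF that] by (simp add: n_def K_def)
  have l_le: "cmod (l z y) \<le> (\<Sum>j\<in>UNIV. cmod (z $ j) * \<bar>y $ j\<bar>)" for z y
    unfolding l_def norm_mult using norm_sum[of "\<lambda>j. z $ j * complex_of_real (y $ j)" UNIV]
    by (simp add: norm_mult)
  have l_le_n: "cmod (l z y) \<le> n y * norm z" for z y
  proof -
    have "(\<Sum>j\<in>UNIV. cmod (z $ j) * \<bar>y $ j\<bar>) \<le> (\<Sum>j\<in>UNIV. norm z * \<bar>y $ j\<bar>)"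
      by (intro sum_mono mult_right_mono Finite_Cartesian_Product.norm_nth_le) auto
    then show ?thesis using l_le[of z y] by (simp add: n_def sum_distrib_left mult.commute)
  qed
  have l_meas: "l z \<in> borel_measurable lebesgue" for z
    unfolding l_def by (intro borel_measurable_lebesgue_continuous continuous_intros)
  have "entire_multi F"
    unfolding entire_multi_def
  proof (intro allI)
    fix z
    define D where "D v = (LINT y|lebesgue. g y * exp (l z y) * l v y)" for v
    have "(F has_derivative D) (at z)"
      unfolding F_def D_def
    proof (rule has_derivative_integral_exp_linear[OF g _ l_meas l_le_n n_nonneg zero_less_one])
      show "linear (\<lambda>v. l v y)" for y
      proof (rule linearI)
        show "l (v + w) y = l v y + l w y" for v w
          by (simp add: l_def algebra_simps sum.distrib)
        show "l (c *\<^sub>R v) y = c *\<^sub>R l v y" for c v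
          by (simp add: l_def flip: scaleR_sum_right)
      qed
      show "cmod (exp (l z y)) * (1 + n y)\<^sup>2 * exp (1 * n y) \<le> exp (K * norm z) * (1 + K)\<^sup>2 * exp K"
        if "g y \<noteq> 0" for y
      proof -
        have "cmod (exp (l z y)) \<le> exp (cmod (l z y))" by (rule norm_exp)
        also have "\<dots> \<le> exp (K * norm z)"
          using l_le_n[of z y] mult_right_mono[OF n_le[OF that] norm_ge_zero[of z]] by simp
        finally show ?thesis
          using n_le[OF that] n_nonneg[of y] by (intro mult_mono power_mono) auto
      qed
    qed
    moreover have "D (c *s v) = c * D v" for c v
    proof -
      have "l (c *s v) y = c * l v y" for y by (simp add: l_def sum_distrib_left mult_ac)
      then have "g y * exp (l z y) * l (c *s v) y = c * (g y * exp (l z y) * l v y)" for y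
        by (simp add: mult_ac)
      then show ?thesis by (simp only: D_def integral_mult_right_zero)
    qed
    ultimately show "\<exists>D. (F has_derivative D) (at z) \<and> (\<forall>c v. D (c *s v) = c * D v)" by blast
  qed
  moreover have "exponential_type_each_le pi F"
    unfolding exponential_type_each_le_def exponential_type_le_def
  proof (intro allI impI)
    fix j and z :: "complex ^ 'd" and \<epsilon> :: real
    assume "\<epsilon> > 0"
    define S where "S = (\<Sum>i\<in>UNIV - {j}. cmod (z $ i))"
    have "cmod (F (\<chi> i. if i = j then w else z $ i))
        \<le> ((LINT y|lebesgue. cmod (g y)) * exp (pi * S)) * exp ((pi + \<epsilon>) * cmod w)" for w
    proof -
      define z' where "z' = (\<chi> i. if i = j then w else z $ i)"
      define R where "R = exp (pi * S) * exp ((pi + \<epsilon>) * cmod w)"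
      have z'_sum: "(\<Sum>i\<in>UNIV. cmod (z' $ i)) = cmod w + S"
        by (simp add: z'_def S_def sum.remove[of UNIV j])
      have le: "cmod (g y * exp (l z' y)) \<le> R * cmod (g y)" for y
      proof (cases "g y = 0")
        case False
        have "cmod (exp (l z' y)) \<le> exp (cmod (l z' y))" by (rule norm_exp)
        also have "\<dots> \<le> exp (\<Sum>i\<in>UNIV. cmod (z' $ i) * \<bar>y $ i\<bar>)" using l_le by simp
        also have "\<dots> \<le> exp (\<Sum>i\<in>UNIV. cmod (z' $ i) * pi)"
          using coord[OF False] by (simp add: sum_mono mult_left_mono)
        also have "\<dots> = exp (pi * S + pi * cmod w)"
          unfolding sum_distrib_right[symmetric] z'_sum by (simp add: algebra_simps)
        also have "\<dots> \<le> R"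
          using \<open>\<epsilon> > 0\<close> by (simp add: R_def distrib_right flip: exp_add)
        finally have "cmod (exp (l z' y)) \<le> R" .
        from mult_right_mono[OF this norm_ge_zero[of "g y"]] show ?thesis
          by (simp add: norm_mult mult.commute)
      qed auto
      have dom: "integrable lebesgue (\<lambda>y. R * cmod (g y))" using g by simp
      have exp_meas: "(\<lambda>y. exp (l z' y)) \<in> borel_measurable lebesgue"
        unfolding l_def by (intro borel_measurable_lebesgue_continuous continuous_intros)
      have "integrable lebesgue (\<lambda>y. g y * exp (l z' y))"
      proof (rule Bochner_Integration.integrable_bound[OF dom])
        show "(\<lambda>y. g y * exp (l z' y)) \<in> borel_measurable lebesgue"
          using g exp_meas by (intro borel_measurable_times) auto
        show "AE y in lebesgue. norm (g y * exp (l z' y)) \<le> norm (R * cmod (g y))"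
          by (intro AE_I2 order_trans[OF le]) simp
      qed
      then have "cmod (F z') \<le> (LINT y|lebesgue. R * cmod (g y))"
        unfolding F_def using dom le by (rule norm_integral_le_integral)
      then show ?thesis by (simp add: z'_def R_def mult_ac)
    qed
    then show "\<exists>C. \<forall>w. cmod (F (\<chi> i. if i = j then w else z $ i)) \<le> C * exp ((pi + \<epsilon>) * cmod w)"
      by blast
  qed
  moreover have "f x = F (\<chi> j. complex_of_real (x $ j))" for x
    unfolding f F_def l_def by (simp add: inner_vec_def)
  ultimately show ?thesis unfolding restricts_entire_of_type_def by blast
qed

text \<open>Injectivity of the transform makes the representing function unique almost everywhere, so the one
selected in the definition of the norm may be replaced by any other.\<close>

lemma wiener_norm_eq:
  fixes f g :: "real ^ 'd \<Rightarrow> complex"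
  assumes "wiener_represents g f"
  shows "wiener_norm f = (LINT y|lebesgue. cmod (g y))"
proof -
  define g' where "g' = (SOME g. wiener_represents g f)"
  have rep': "wiener_represents g' f" unfolding g'_def by (rule someI[of "\<lambda>g. wiener_represents g f", OF assms])
  have int: "integrable lebesgue g" "integrable lebesgue g'"
    using assms rep' by (auto simp: wiener_represents_def)
  have exp_int: "integrable lebesgue (\<lambda>y. k y * exp (- \<i> * complex_of_real (x \<bullet> y)))"
    if "integrable lebesgue k" for k :: "real ^ 'd \<Rightarrow> complex" and x
    by (intro integrable_mult_phase that continuous_intros)
  have "AE y in lebesgue. g' y - g y = 0"
  proof (rule fourier_transform_zero_imp_AE_zero)
    show "(LINT y|lebesgue. (g' y - g y) * exp (- \<i> * complex_of_real (x \<bullet> y))) = 0" for x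
      using assms rep' exp_int[OF int(1)] exp_int[OF int(2)]
      by (simp add: wiener_represents_def left_diff_distrib)
  qed (use int in auto)
  then have "AE y in lebesgue. cmod (g' y) = cmod (g y)" by eventually_elim simp
  then show ?thesis unfolding wiener_norm_def g'_def[symmetric]
    using int by (intro integral_cong_AE) auto
qed


section \<open>Minimal extensions\<close>

lemma torus_box_eq_period_cell: "torus_box = cbox (\<chi> j. - (pi / 1)) (\<chi> j. pi / 1)"
  by (simp add: torus_box_def)

theorem mainTheorem2:
  fixes \<phi> :: "int ^ 'd \<Rightarrow> complex" and \<Phi> :: "real ^ 'd \<Rightarrow> complex"
  assumes "set_integrable lebesgue torus_box \<Phi>"
    and "is_fourier_series_of \<phi> \<Phi>"
  shows "(\<exists>f\<in>wiener_extensions \<phi>.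
            wiener_norm f = 1 / (2 * pi) ^ CARD('d) * (LINT x:torus_box|lebesgue. cmod (\<Phi> x)))
       \<and> (\<forall>f\<in>wiener_extensions \<phi>.
            1 / (2 * pi) ^ CARD('d) * (LINT x:torus_box|lebesgue. cmod (\<Phi> x)) \<le> wiener_norm f)
       \<and> (\<exists>!f. is_arg_min wiener_norm (\<lambda>f. f \<in> wiener_extensions \<phi>) f
            \<and> restricts_entire_of_type pi f)"
proof -
  define c where "c = 1 / (2 * pi) ^ CARD('d)"
  define N where "N = c * (LINT x:torus_box|lebesgue. cmod (\<Phi> x))"
  define g0 where "g0 y = of_real c * (indicator torus_box y *\<^sub>R \<Phi> y)" for y
  define f0 where "f0 x = (LINT y|lebesgue. g0 y * exp (- \<i> * complex_of_real (x \<bullet> y)))" for x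
  have "c > 0" by (simp add: c_def)
  have g0_int: "integrable lebesgue g0"
    using assms(1) unfolding g0_def set_integrable_def by (intro integrable_mult_right)
  have rep0: "wiener_represents g0 f0"
    using g0_int by (simp add: wiener_represents_def f0_def)
  have g0_support: "y \<in> torus_box" if "g0 y \<noteq> 0" for y
    using that by (auto simp: g0_def indicator_def split: if_splits)
  have f0_lattice: "f0 (lattice_point k) = \<phi> k" for k
  proof -
    have "f0 (lattice_point k) = (LINT y|lebesgue. of_real c *
        (indicator torus_box y *\<^sub>R (\<Phi> y * exp (- \<i> * complex_of_real (lattice_point k \<bullet> y)))))"
      unfolding f0_def g0_def by (simp only: mult.assoc mult_scaleR_left)
    also have "\<dots> = fourier_coefficient \<Phi> k"
      unfolding fourier_coefficient_def set_lebesgue_integral_def c_def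
      by (subst integral_mult_right_zero) simp
    also have "\<dots> = \<phi> k" using assms(2) by (simp add: is_fourier_series_of_def)
    finally show ?thesis .
  qed
  have f0_ext: "f0 \<in> wiener_extensions \<phi>"
    using rep0 f0_lattice by (auto simp: wiener_extensions_def wiener_algebra_def)
  have N_eq: "N = (LINT y|lebesgue. cmod (g0 y))"
  proof -
    have "cmod (g0 y) = c * (indicator torus_box y *\<^sub>R cmod (\<Phi> y))" for y
      using \<open>c > 0\<close> by (simp add: g0_def norm_mult indicator_def)
    then show ?thesis by (simp add: N_def set_lebesgue_integral_def)
  qed
  have N_box: "N = (LINT y:torus_box|lebesgue. cmod (g0 y))"
    unfolding N_eq set_lebesgue_integral_def
    by (intro Bochner_Integration.integral_cong) (auto simp: g0_def indicator_def)
  have norm0: "wiener_norm f0 = N" using wiener_norm_eq[OF rep0] N_eq by simp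
  have defect: "integrable lebesgue g \<and>
      (LINT y:torus_box|lebesgue. cmod (g y - g0 y)) \<le> (LINT y:-torus_box|lebesgue. cmod (g y - g0 y))"
    if f: "f \<in> wiener_extensions \<phi>" and rep: "wiener_represents g f" for f g
  proof
    show g_int: "integrable lebesgue g" using rep by (simp add: wiener_represents_def)
    show "(LINT y:torus_box|lebesgue. cmod (g y - g0 y)) \<le> (LINT y:-torus_box|lebesgue. cmod (g y - g0 y))"
    proof (rule mass_in_period_cell_le[where a = 1, OF _ _ _ torus_box_eq_period_cell])
      show "integrable lebesgue (\<lambda>y. g y - g0 y)" using g_int g0_int by simp
      show "(LINT y|lebesgue. (g y - g0 y) * exp (- \<i> * complex_of_real (1 * (lattice_point k \<bullet> y)))) = 0" for k
      proof -
        have int: "integrable lebesgue (\<lambda>y. g y * exp (- \<i> * complex_of_real (lattice_point k \<bullet> y)))"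
          "integrable lebesgue (\<lambda>y. g0 y * exp (- \<i> * complex_of_real (lattice_point k \<bullet> y)))"
          by (intro integrable_mult_phase g_int g0_int continuous_intros)+
        have "f (lattice_point k) = f0 (lattice_point k)"
          using f f0_lattice by (simp add: wiener_extensions_def)
        then have "(LINT y|lebesgue. g y * exp (- \<i> * complex_of_real (lattice_point k \<bullet> y)))
            = (LINT y|lebesgue. g0 y * exp (- \<i> * complex_of_real (lattice_point k \<bullet> y)))"
          using rep by (simp add: wiener_represents_def f0_def)
        then show ?thesis
          unfolding left_diff_distrib mult_1_left
          by (subst Bochner_Integration.integral_diff[OF int]) simp
      qed
    qed simp
  qed
  have box_sets: "torus_box \<in> sets lebesgue" "- torus_box \<in> sets lebesgue"
    by (auto simp: torus_box_def)
  have lower: "N \<le> wiener_norm f" if f: "f \<in> wiener_extensions \<phi>" for f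
  proof -
    obtain g where rep: "wiener_represents g f"
      using f by (auto simp: wiener_extensions_def wiener_algebra_def)
    note g_int = defect[OF f rep, THEN conjunct1]
    have set_int: "set_integrable lebesgue A (\<lambda>y. cmod (k y))"
      if "A \<in> sets lebesgue" "integrable lebesgue k" for A and k :: "real ^ 'd \<Rightarrow> complex"
      unfolding set_integrable_def using that by (intro integrable_mult_indicator) auto
    have diff_int: "integrable lebesgue (\<lambda>y. g y - g0 y)" using g_int g0_int by simp
    \<comment> \<open>In the cube \<open>g\<^sub>0\<close> is at most \<open>g\<close> plus the defect \<open>g - g\<^sub>0\<close>, and the mass of the defect there is
      at most its mass outside, where the defect is \<open>g\<close>.\<close>
    have "N \<le> (LINT y:torus_box|lebesgue. cmod (g y) + cmod (g y - g0 y))"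
      unfolding N_box
    proof (rule set_integral_mono)
      show "cmod (g0 y) \<le> cmod (g y) + cmod (g y - g0 y)" for y
        using norm_triangle_ineq4[of "g y" "g y - g0 y"] by simp
    qed (intro set_integral_add set_int box_sets g0_int g_int diff_int)+
    also have "\<dots> = (LINT y:torus_box|lebesgue. cmod (g y)) + (LINT y:torus_box|lebesgue. cmod (g y - g0 y))"
      by (intro set_integral_add set_int box_sets g_int diff_int)
    also have "\<dots> \<le> (LINT y:torus_box|lebesgue. cmod (g y)) + (LINT y:-torus_box|lebesgue. cmod (g y - g0 y))"
      using defect[OF f rep] by simp
    also have "(LINT y:-torus_box|lebesgue. cmod (g y - g0 y)) = (LINT y:-torus_box|lebesgue. cmod (g y))"
      unfolding set_lebesgue_integral_def
      by (intro Bochner_Integration.integral_cong) (auto simp: g0_def indicator_def)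
    also have "(LINT y:torus_box|lebesgue. cmod (g y)) + (LINT y:-torus_box|lebesgue. cmod (g y))
        = (LINT y:torus_box \<union> - torus_box|lebesgue. cmod (g y))"
      by (intro set_integral_Un[symmetric] set_int box_sets g_int) auto
    also have "\<dots> = (LINT y|lebesgue. cmod (g y))"
      by (simp add: set_lebesgue_integral_def)
    also have "\<dots> = wiener_norm f" using wiener_norm_eq[OF rep] by simp
    finally show ?thesis .
  qed
  have unique: "f = f0" if f: "f \<in> wiener_extensions \<phi>" and entire: "restricts_entire_of_type pi f" for f
  proof -
    obtain g where rep: "wiener_represents g f"
      using f by (auto simp: wiener_extensions_def wiener_algebra_def)
    note g_int = defect[OF f rep, THEN conjunct1]
    have support: "AE y in lebesgue. y \<notin> torus_box \<longrightarrow> g y = 0"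
      by (rule paley_wiener_support[OF rep entire])
    have diff_int: "integrable lebesgue (\<lambda>y. cmod (g y - g0 y))" using g_int g0_int by simp
    have inside: "integrable lebesgue (\<lambda>y. indicator torus_box y *\<^sub>R cmod (g y - g0 y))"
      and outside: "integrable lebesgue (\<lambda>y. indicator (- torus_box) y *\<^sub>R cmod (g y - g0 y))"
      by (intro integrable_mult_indicator box_sets diff_int)+
    have out: "AE y in lebesgue. indicator (- torus_box) y *\<^sub>R cmod (g y - g0 y) = 0"
      using support by eventually_elim (auto simp: g0_def indicator_def)
    then have "(LINT y:-torus_box|lebesgue. cmod (g y - g0 y)) = 0"
      unfolding set_lebesgue_integral_def by (rule integral_eq_zero_AE)
    then have "(LINT y|lebesgue. indicator torus_box y *\<^sub>R cmod (g y - g0 y)) = 0"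
      using defect[OF f rep] unfolding set_lebesgue_integral_def
      by (intro antisym) (auto intro!: integral_nonneg_AE)
    then have "AE y in lebesgue. indicator torus_box y *\<^sub>R cmod (g y - g0 y) = 0"
      using integral_nonneg_eq_0_iff_AE[OF inside] by simp
    with out have "AE y in lebesgue. g y = g0 y"
      by eventually_elim (auto simp: indicator_def split: if_splits)
    then have AE_eq: "AE y in lebesgue. g y * exp (- \<i> * complex_of_real (x \<bullet> y))
        = g0 y * exp (- \<i> * complex_of_real (x \<bullet> y))" for x
      by eventually_elim simp
    have meas: "(\<lambda>y. k y * exp (- \<i> * complex_of_real (x \<bullet> y))) \<in> borel_measurable lebesgue"
      if "integrable lebesgue k" for k :: "real ^ 'd \<Rightarrow> complex" and x
      by (intro borel_measurable_integrable integrable_mult_phase that continuous_intros)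
    have "f x = f0 x" for x
      using rep integral_cong_AE[OF meas[OF g_int] meas[OF g0_int] AE_eq[of x]]
      by (simp add: wiener_represents_def f0_def)
    then show ?thesis by (rule ext)
  qed
  have min0: "is_arg_min wiener_norm (\<lambda>f. f \<in> wiener_extensions \<phi>) f0"
    using f0_ext lower norm0 by (auto simp: is_arg_min_def not_less)
  have entire0: "restricts_entire_of_type pi f0"
    by (rule restricts_entire_of_box_support[OF rep0 g0_support])
  have "\<exists>!f. is_arg_min wiener_norm (\<lambda>f. f \<in> wiener_extensions \<phi>) f \<and> restricts_entire_of_type pi f"
  proof (rule ex1I[of _ f0])
    show "is_arg_min wiener_norm (\<lambda>f. f \<in> wiener_extensions \<phi>) f0 \<and> restricts_entire_of_type pi f0"
      using min0 entire0 by (rule conjI)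
    show "f = f0" if "is_arg_min wiener_norm (\<lambda>f. f \<in> wiener_extensions \<phi>) f \<and> restricts_entire_of_type pi f" for f
      using that by (intro unique) (simp_all add: is_arg_min_def)
  qed
  moreover have "\<exists>f\<in>wiener_extensions \<phi>. wiener_norm f = N"
    using f0_ext norm0 by (intro bexI[of _ f0])
  moreover have "\<forall>f\<in>wiener_extensions \<phi>. N \<le> wiener_norm f"
    by (rule ballI) (rule lower)
  ultimately show ?thesis unfolding N_def c_def by (intro conjI)
qed

end
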